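(* Let $A\in\mathbb{R}^{n\times n}$, $B\in\mathbb{R}^{n\times m}$, $C\in\mathbb{R}^{p\times n}$, $D\in\mathbb{R}^{p\times m}$, $K\in\mathbb{R}^{r\times n}$ and consider the system $$\dot x(t)=Ax(t)+Bu(t),\qquad y(t)=Cx(t)+Du(t),\qquad z(t)=Kx(t).\qquad(\mathrm{S})$$ If $(A,C)$ is partially detectable with respect to $K$, then there exist $q\in\mathbb{N}\cup\{0\}$ and matrices $N\in\mathbb{R}^{q\times q}$, $H\in\mathbb{R}^{q\times m}$, $L\in\mathbb{R}^{q\times p}$, $R\in\mathbb{R}^{r\times q}$ such that the system $$\dot w(t)=Nw(t)+Hu(t)+Ly(t),\qquad \hat z(t)=Rw(t)\qquad(\mathrm{E})$$ is a partial state estimator for (S).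
   Context: $\mathscr{L}^1_{loc}(\mathbb{R};\mathbb{R}^k)$ is the set of locally Lebesgue integrable $\mathbb{R}^k$-valued functions on $\mathbb{R}$. Solutions of the systems are tuples of such functions satisfying the equations almost everywhere, derivatives being understood in the weak sense (so the differentiated variables are locally absolutely continuous). "$z(t)\to 0$ as $t\to\infty$" means $\lim_{t\to\infty}\operatorname{ess\,sup}_{s\ge t}\|z(s)\|=0$. Partial detectability: $(A,C)$ is partially detectable with respect to $K$ if for all solutions $(x_1,u,y,z_1),(x_2,u,y,z_2)\in\mathscr{L}^1_{loc}(\mathbb{R};\mathbb{R}^{n+m+p+r})$ of (S) (with the same $u$ and $y$) we have $z_1(t)-z_2(t)\to0$ as $t\to\infty$; equivalently, every solution of (S) of the form $(x,0,0,z)$ satisfies $z(t)\to0$ as $t\to\infty$. Partial state estimator: (E) is a partial state estimator for (S) if for every solution $(x,u,y,z)\in\mathscr{L}^1_{loc}(\mathbb{R};\mathbb{R}^{n+m+p+r})$ of (S) and every solution $(w,[u^\top\ y^\top]^\top,\hat z)\in\mathscr{L}^1_{loc}(\mathbb{R};\mathbb{R}^{q+m+p+r})$ of (E) with the same $u,y$, we have $\hat z(t)-z(t)\to0$ as $t\to\infty$. *)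

theory Defs
  imports "HOL-Probability.Probability" "Jordan_Normal_Form.Matrix"
begin

unbundle no vec_syntax

text \<open>
  Dimensions are natural numbers carried by the vectors and matrices themselves (and may be 0),
  so that the state dimension of an estimator can be quantified existentially.
  Functions are honest functions, not classes modulo null sets; every notion
  below is invariant under changing the functions on a null set.
\<close>

definition L1_loc :: "nat \<Rightarrow> (real \<Rightarrow> real vec) set" where
  "L1_loc k = {f. (\<forall>t. f t \<in> carrier_vec k) \<and>
     (\<forall>i<k. \<forall>S. compact S \<longrightarrow> set_integrable lebesgue S (\<lambda>t. f t $ i))}"

definition test_function :: "(real \<Rightarrow> real) \<Rightarrow> bool" where
  "test_function \<phi> \<longleftrightarrow>
     (\<forall>j t. (deriv ^^ j) \<phi> field_differentiable (at t)) \<and> compact (closure {t. \<phi> t \<noteq> 0})"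

definition weak_derivative :: "nat \<Rightarrow> (real \<Rightarrow> real vec) \<Rightarrow> (real \<Rightarrow> real vec) \<Rightarrow> bool" where
  "weak_derivative k f g \<longleftrightarrow> f \<in> L1_loc k \<and> g \<in> L1_loc k \<and>
     (\<forall>\<phi>. test_function \<phi> \<longrightarrow> (\<forall>i<k.
        (LINT t|lebesgue. f t $ i * deriv \<phi> t) = - (LINT t|lebesgue. g t $ i * \<phi> t)))"

definition system_solution ::
  "real mat \<Rightarrow> real mat \<Rightarrow> real mat \<Rightarrow> real mat \<Rightarrow> real mat \<Rightarrow>
   (real \<Rightarrow> real vec) \<Rightarrow> (real \<Rightarrow> real vec) \<Rightarrow> (real \<Rightarrow> real vec) \<Rightarrow> (real \<Rightarrow> real vec) \<Rightarrow> bool" where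
  "system_solution A B C D K x u y z \<longleftrightarrow>
     x \<in> L1_loc (dim_row A) \<and> u \<in> L1_loc (dim_col B) \<and>
     y \<in> L1_loc (dim_row C) \<and> z \<in> L1_loc (dim_row K) \<and>
     (\<exists>x'. weak_derivative (dim_row A) x x' \<and>
           (AE t in lebesgue. x' t = A *\<^sub>v x t + B *\<^sub>v u t)) \<and>
     (AE t in lebesgue. y t = C *\<^sub>v x t + D *\<^sub>v u t) \<and>
     (AE t in lebesgue. z t = K *\<^sub>v x t)"

definition estimator_solution ::
  "real mat \<Rightarrow> real mat \<Rightarrow> real mat \<Rightarrow> real mat \<Rightarrow>
   (real \<Rightarrow> real vec) \<Rightarrow> (real \<Rightarrow> real vec) \<Rightarrow> (real \<Rightarrow> real vec) \<Rightarrow> (real \<Rightarrow> real vec) \<Rightarrow> bool" where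
  "estimator_solution N H L R w u y zh \<longleftrightarrow>
     w \<in> L1_loc (dim_row N) \<and> u \<in> L1_loc (dim_col H) \<and>
     y \<in> L1_loc (dim_col L) \<and> zh \<in> L1_loc (dim_row R) \<and>
     (\<exists>w'. weak_derivative (dim_row N) w w' \<and>
           (AE t in lebesgue. w' t = N *\<^sub>v w t + H *\<^sub>v u t + L *\<^sub>v y t)) \<and>
     (AE t in lebesgue. zh t = R *\<^sub>v w t)"

definition eucl_norm :: "real vec \<Rightarrow> real" where
  "eucl_norm v = sqrt (scalar_prod v v)"

definition ess_tends_to_0 :: "(real \<Rightarrow> real vec) \<Rightarrow> bool" where
  "ess_tends_to_0 f \<longleftrightarrow>
     ((\<lambda>t. esssup (restrict_space lebesgue {t..}) (\<lambda>s. ereal (eucl_norm (f s)))) \<longlongrightarrow> 0) at_top"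

definition partially_detectable ::
  "real mat \<Rightarrow> real mat \<Rightarrow> real mat \<Rightarrow> real mat \<Rightarrow> real mat \<Rightarrow> bool" where
  "partially_detectable A B C D K \<longleftrightarrow>
     (\<forall>x1 x2 u y z1 z2. system_solution A B C D K x1 u y z1 \<longrightarrow>
        system_solution A B C D K x2 u y z2 \<longrightarrow> ess_tends_to_0 (\<lambda>t. z1 t - z2 t))"

definition partial_state_estimator ::
  "real mat \<Rightarrow> real mat \<Rightarrow> real mat \<Rightarrow> real mat \<Rightarrow> real mat \<Rightarrow>
   real mat \<Rightarrow> real mat \<Rightarrow> real mat \<Rightarrow> real mat \<Rightarrow> bool" where
  "partial_state_estimator A B C D K N H L R \<longleftrightarrow>
     (\<forall>x u y z w zh. system_solution A B C D K x u y z \<longrightarrow>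
        estimator_solution N H L R w u y zh \<longrightarrow> ess_tends_to_0 (\<lambda>t. zh t - z t))"

end

theory Submission
  imports Defs "Jordan_Normal_Form.Determinant" "HOL-Computational_Algebra.Fundamental_Theorem_Algebra"
begin

text \<open>
  Let \<open>V\<close> be the unobservable subspace of \<open>(A, C)\<close>. For \<open>v \<in> V\<close> the solution \<open>e\<^sup>t\<^sup>A v\<close> has zero input and
  output, so detectability gives \<open>K e\<^sup>t\<^sup>A v \<longrightarrow> 0\<close>. Hence the monic polynomial \<open>\<chi>\<close> of least degree with
  \<open>K \<chi>(A) = 0\<close> on \<open>V\<close> is stable. A stable multiple \<open>a\<close> of \<open>\<chi>\<close> of large degree \<open>d\<close> satisfies
  \<open>K a(A) = \<Sum>\<^sub>j Y\<^sub>j C A\<^sup>j\<close> with \<open>j < d\<close>, because \<open>V\<close> is the common kernel of the \<open>C A\<^sup>j\<close>.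
  The estimator in observer form
  \<open>w\<^sub>k' = w\<^sub>k\<^sub>+\<^sub>1 - a\<^sub>d\<^sub>-\<^sub>1\<^sub>-\<^sub>k w\<^sub>0 + Y\<^sub>d\<^sub>-\<^sub>1\<^sub>-\<^sub>k y + H\<^sub>k u\<close> with output \<open>w\<^sub>0\<close> then has the error
  \<open>e\<^sub>k = w\<^sub>k - T\<^sub>k x\<close>, where \<open>T\<^sub>0 = K\<close> and \<open>T\<^sub>k\<^sub>+\<^sub>1 = T\<^sub>k A + a\<^sub>d\<^sub>-\<^sub>1\<^sub>-\<^sub>k K - Y\<^sub>d\<^sub>-\<^sub>1\<^sub>-\<^sub>k C\<close>, and \<open>T\<^sub>d = 0\<close>
  by the choice of the \<open>Y\<^sub>j\<close>. Therefore the scalar equation \<open>a(d/dt) e\<^sub>0 = 0\<close> holds, and its solutions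
  tend to \<open>0\<close>. No pole placement is needed, since the state may have dimension \<open>d r\<close>.
\<close>

subsection \<open>Smooth test functions\<close>

text \<open>The analytic obstacle is that the errors e_k are only weakly differentiable, so that
  a(d/dt) e_0 = 0 has no meaning at first. On t >= 0 each error is therefore shown to equal, almost
  everywhere, a constant plus the primitive of its weak derivative. With these continuous versions
  on the right-hand side the error system becomes classical for t > 0 and can be differentiated any
  number of times.

  The recursion for T_k is forced by asking for e_k' = e_{k+1} - a_{d-1-k} e_0, and H_k = T_k B -
  Y_{d-1-k} D by asking that \<open>u\<close> drop out. Unrolled, T_d is K a(A) minus the sum of the
  Y_j C A^j, so the chain closes precisely when K a(A) is that combination of observations. On V all
  observations vanish; this is why \<open>a\<close> has to annihilate K on V, and why detectability
  is used to make such a polynomial stable.\<close>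

primrec times_differentiable :: "nat \<Rightarrow> (real \<Rightarrow> real) \<Rightarrow> bool" where
  "times_differentiable 0 f \<longleftrightarrow> True"
| "times_differentiable (Suc k) f \<longleftrightarrow>
     (\<forall>t. f field_differentiable at t) \<and> times_differentiable k (deriv f)"

text \<open>\<open>times_differentiable\<close> takes off the innermost derivative, so each closure
  property below needs only a formula for the first derivative and the induction hypothesis;
  \<open>smooth_deriv_funpow\<close> returns to the iterates in
  \<open>test_function\<close>.\<close>

lemma times_differentiable_Suc_I:
  assumes "\<And>t. (f has_real_derivative f' t) (at t)" and "times_differentiable k f'"
  shows "times_differentiable (Suc k) f"
proof -
  have "deriv f = f'"
    using assms(1) by (auto intro: DERIV_imp_deriv)
  then show ?thesis
    using assms by (auto simp: field_differentiable_def)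
qed

lemma times_differentiable_DERIV:
  "times_differentiable (Suc k) f \<Longrightarrow> (f has_real_derivative deriv f t) (at t)"
  by (simp add: DERIV_deriv_iff_field_differentiable)

lemma times_differentiable_SucD: "times_differentiable (Suc k) f \<Longrightarrow> times_differentiable k f"
proof (induction k arbitrary: f)
  case (Suc k)
  then show ?case
    by simp
qed simp

lemma times_differentiable_const: "times_differentiable k (\<lambda>_. c)"
proof (induction k arbitrary: c)
  case (Suc k)
  show ?case
    by (rule times_differentiable_Suc_I[where f' = "\<lambda>_. 0"]) (use Suc in auto)
qed simp

lemma times_differentiable_add:
  "times_differentiable k f \<Longrightarrow> times_differentiable k g \<Longrightarrow> times_differentiable k (\<lambda>x. f x + g x)"
proof (induction k arbitrary: f g)
  case (Suc k)
  note D = times_differentiable_DERIV[OF Suc.prems(1)] times_differentiable_DERIV[OF Suc.prems(2)]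
  show ?case
    by (rule times_differentiable_Suc_I[where f' = "\<lambda>x. deriv f x + deriv g x"])
      (use Suc D in \<open>auto intro!: derivative_eq_intros\<close>)
qed simp

lemma times_differentiable_mult:
  "times_differentiable k f \<Longrightarrow> times_differentiable k g \<Longrightarrow> times_differentiable k (\<lambda>x. f x * g x)"
proof (induction k arbitrary: f g)
  case (Suc k)
  note D = times_differentiable_DERIV[OF Suc.prems(1)] times_differentiable_DERIV[OF Suc.prems(2)]
  show ?case
  proof (rule times_differentiable_Suc_I[where f' = "\<lambda>x. deriv f x * g x + f x * deriv g x"])
    show "((\<lambda>x. f x * g x) has_real_derivative deriv f t * g t + f t * deriv g t) (at t)" for t
      by (rule derivative_eq_intros D refl)+ (simp add: algebra_simps)
    show "times_differentiable k (\<lambda>x. deriv f x * g x + f x * deriv g x)"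
      using Suc.prems times_differentiable_SucD
      by (auto intro!: times_differentiable_add Suc.IH)
  qed
qed simp

lemma times_differentiable_inverse:
  "times_differentiable k f \<Longrightarrow> (\<And>x. f x \<noteq> 0) \<Longrightarrow> times_differentiable k (\<lambda>x. inverse (f x))"
proof (induction k arbitrary: f)
  case (Suc k)
  note D = times_differentiable_DERIV[OF Suc.prems(1)]
  show ?case
  proof (rule times_differentiable_Suc_I[where f' = "\<lambda>x. (- 1) * (deriv f x * (inverse (f x) * inverse (f x)))"])
    show "((\<lambda>x. inverse (f x)) has_real_derivative (- 1) * (deriv f t * (inverse (f t) * inverse (f t)))) (at t)" for t
      by (rule derivative_eq_intros D refl)+ (simp_all add: Suc.prems)
    show "times_differentiable k (\<lambda>x. (- 1) * (deriv f x * (inverse (f x) * inverse (f x))))"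
      using Suc.prems times_differentiable_SucD
      by (intro times_differentiable_mult Suc.IH times_differentiable_const) auto
  qed
qed simp

lemma times_differentiable_affine:
  "times_differentiable k f \<Longrightarrow> times_differentiable k (\<lambda>x. f (c * x + b))"
proof (induction k arbitrary: f)
  case (Suc k)
  show ?case
  proof (rule times_differentiable_Suc_I[where f' = "\<lambda>x. c * deriv f (c * x + b)"])
    show "((\<lambda>x. f (c * x + b)) has_real_derivative c * deriv f (c * t + b)) (at t)" for t
      by (rule DERIV_chain2[OF times_differentiable_DERIV[OF Suc.prems(1)], THEN DERIV_cong])
        (auto intro!: derivative_eq_intros)
    show "times_differentiable k (\<lambda>x. c * deriv f (c * x + b))"
      using Suc.prems by (intro times_differentiable_mult times_differentiable_const Suc.IH[of "deriv f"]) auto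
  qed
qed simp

lemma times_differentiable_id: "times_differentiable k (\<lambda>x. x)"
proof (cases k)
  case (Suc k)
  show ?thesis
    unfolding Suc by (rule times_differentiable_Suc_I[where f' = "\<lambda>_. 1"])
      (auto simp: times_differentiable_const)
qed simp

definition smooth :: "(real \<Rightarrow> real) \<Rightarrow> bool" where
  "smooth f \<longleftrightarrow> (\<forall>k. times_differentiable k f)"

lemma smooth_deriv_funpow:
  assumes "smooth f"
  shows "(deriv ^^ j) f field_differentiable (at t)"
proof -
  have "times_differentiable (Suc j) f \<Longrightarrow> (deriv ^^ j) f field_differentiable (at t)" for f
  proof (induction j arbitrary: f)
    case (Suc j)
    then show ?case
      using Suc.IH[of "deriv f"] by (simp add: funpow_swap1)
  qed simp
  then show ?thesis
    using assms by (simp only: smooth_def)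
qed

lemma smooth_DERIV: "smooth f \<Longrightarrow> (f has_real_derivative deriv f t) (at t)"
  by (rule times_differentiable_DERIV[of 0]) (simp add: smooth_def)

lemma smooth_deriv: "smooth f \<Longrightarrow> smooth (deriv f)"
  unfolding smooth_def using times_differentiable.simps(2)[of _ f] by blast

lemma smooth_continuous_on: "smooth f \<Longrightarrow> continuous_on S f"
  by (rule DERIV_continuous_on, rule has_field_derivative_at_within, rule smooth_DERIV)

lemma smooth_intros:
  shows "smooth (\<lambda>_. c)"
    and "smooth (\<lambda>x. x)"
    and "smooth f \<Longrightarrow> smooth g \<Longrightarrow> smooth (\<lambda>x. f x + g x)"
    and "smooth f \<Longrightarrow> smooth g \<Longrightarrow> smooth (\<lambda>x. f x * g x)"
    and "smooth f \<Longrightarrow> (\<And>x. f x \<noteq> 0) \<Longrightarrow> smooth (\<lambda>x. inverse (f x))"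
    and "smooth f \<Longrightarrow> smooth (\<lambda>x. f (b * x + b'))"
  by (simp_all add: smooth_def times_differentiable_const times_differentiable_id
      times_differentiable_add times_differentiable_mult times_differentiable_inverse
      times_differentiable_affine)

text \<open>For \<open>p = 1\<close> this is the classical flat function exp(-1/x). The polynomial
  factor in 1/x makes the family closed under differentiation, so smoothness is one induction for
  all \<open>p\<close> at once.\<close>

definition flat_fun :: "real poly \<Rightarrow> real \<Rightarrow> real" where
  "flat_fun p x = (if 0 < x then poly p (inverse x) * exp (- inverse x) else 0)"

lemma tendsto_poly_exp_minus: "((\<lambda>x. poly p x * exp (- x)) \<longlongrightarrow> (0::real)) at_top"
proof -
  have "((\<lambda>x. \<Sum>i\<le>degree p. coeff p i * (x ^ i / exp x)) \<longlongrightarrow> (\<Sum>i\<le>degree p. coeff p i * 0)) at_top"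
    by (intro tendsto_intros tendsto_power_div_exp_0)
  moreover have "(\<Sum>i\<le>degree p. coeff p i * (x ^ i / exp x)) = poly p x * exp (- x)" for x :: real
    by (simp add: poly_altdef sum_distrib_right exp_minus divide_inverse mult.assoc)
  ultimately show ?thesis
    by simp
qed

text \<open>With \<open>y = 1/x\<close>, the derivative of \<open>p y e\<^sup>-\<^sup>y\<close> in \<open>x\<close> is \<open>y\<^sup>2 (p y - p' y) e\<^sup>-\<^sup>y\<close>.\<close>

lemma flat_fun_DERIV:
  "(flat_fun p has_real_derivative flat_fun ((p - pderiv p) * [:0, 0, 1:]) t) (at t)"
proof -
  consider "t > 0" | "t = 0" | "t < 0" by linarith
  then show ?thesis
  proof cases
    case 1
    have "((\<lambda>x. poly p (inverse x) * exp (- inverse x)) has_real_derivative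
        flat_fun ((p - pderiv p) * [:0, 0, 1:]) t) (at t)"
      using 1
      by (auto intro!: derivative_eq_intros DERIV_chain2[OF poly_DERIV]
          simp: flat_fun_def algebra_simps power2_eq_square)
    then show ?thesis
      by (rule has_field_derivative_transform_within_open[of _ _ _ "{0<..}"])
        (use 1 in \<open>auto simp: flat_fun_def\<close>)
  next
    case 2
    have "((\<lambda>y. flat_fun p y / y) \<longlongrightarrow> 0) (at_right 0)"
    proof -
      \<comment> \<open>The difference quotient at 0 is a function of the same kind, with
        \<open>p * [:0, 1:]\<close> for \<open>p\<close>, and the exponential beats every polynomial
        in 1/x.\<close>
      have "((\<lambda>x. poly (p * [:0, 1:]) (inverse x) * exp (- inverse x)) \<longlongrightarrow> (0::real)) (at_right 0)"
        by (rule filterlim_compose[OF tendsto_poly_exp_minus filterlim_inverse_at_top_right])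
      then show ?thesis
        by (rule Lim_transform_eventually)
          (auto simp: eventually_at_filter flat_fun_def field_simps)
    qed
    moreover have "((\<lambda>y. flat_fun p y / y) \<longlongrightarrow> 0) (at_left 0)"
      by (rule Lim_transform_eventually[OF tendsto_const])
        (auto simp: eventually_at_filter flat_fun_def)
    ultimately have "((\<lambda>y. flat_fun p y / y) \<longlongrightarrow> 0) (at 0)"
      by (simp add: filterlim_split_at)
    then show ?thesis
      using 2 by (simp add: has_field_derivative_iff flat_fun_def[of _ 0])
  next
    case 3
    have "((\<lambda>_. 0) has_real_derivative flat_fun ((p - pderiv p) * [:0, 0, 1:]) t) (at t)"
      using 3 by (simp add: flat_fun_def)
    then show ?thesis
      by (rule has_field_derivative_transform_within_open[of _ _ _ "{..<0}"])
        (use 3 in \<open>auto simp: flat_fun_def\<close>)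
  qed
qed

lemma smooth_flat_fun: "smooth (flat_fun p)"
proof -
  have "times_differentiable k (flat_fun p)" for k
  proof (induction k arbitrary: p)
    case (Suc k)
    show ?case
      by (rule times_differentiable_Suc_I[OF flat_fun_DERIV Suc])
  qed simp
  then show ?thesis
    by (simp add: smooth_def)
qed

definition smooth_step :: "real \<Rightarrow> real" where
  "smooth_step x = flat_fun 1 x * inverse (flat_fun 1 x + flat_fun 1 (1 - x))"

lemma smooth_smooth_step: "smooth smooth_step"
proof -
  \<comment> \<open>At least one of \<open>x\<close> and \<open>1 - x\<close> is positive.\<close>
  have "flat_fun 1 x + flat_fun 1 (1 - x) \<noteq> 0" for x
    using add_pos_pos[OF exp_gt_zero[of "- inverse x"] exp_gt_zero[of "- inverse (1 - x)"]]
    by (auto simp: flat_fun_def)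
  moreover have "smooth (\<lambda>x. flat_fun 1 (1 - x))"
    using smooth_intros(6)[OF smooth_flat_fun[of 1], of "-1" 1] by simp
  ultimately show ?thesis
    unfolding smooth_step_def[abs_def] by (intro smooth_intros smooth_flat_fun)
qed

lemma smooth_step_range: "0 \<le> smooth_step x" "smooth_step x \<le> 1"
proof -
  have "0 \<le> flat_fun 1 y" for y
    by (simp add: flat_fun_def)
  from this[of x] this[of "1 - x"] show "0 \<le> smooth_step x" "smooth_step x \<le> 1"
    by (auto simp: smooth_step_def divide_le_eq_1 simp flip: divide_inverse)
qed

lemma smooth_step_eq:
  shows "x \<le> 0 \<Longrightarrow> smooth_step x = 0"
    and "x \<ge> 1 \<Longrightarrow> smooth_step x = 1"
  by (auto simp: smooth_step_def flat_fun_def)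

text \<open>A smooth stand-in for \<open>max 0 x\<close>. The product with a step is explicit and
  avoids integrating the step; in exchange the slope between 0 and 1 is only known to be
  bounded.\<close>

definition smooth_ramp :: "real \<Rightarrow> real" where
  "smooth_ramp x = x * smooth_step x"

lemma smooth_smooth_ramp: "smooth smooth_ramp"
  unfolding smooth_ramp_def[abs_def] by (intro smooth_intros smooth_smooth_step)

lemma smooth_ramp_eq:
  shows "x \<le> 0 \<Longrightarrow> smooth_ramp x = 0"
    and "x \<ge> 1 \<Longrightarrow> smooth_ramp x = x"
  by (simp_all add: smooth_ramp_def smooth_step_eq)

lemma abs_smooth_ramp_le: "\<bar>smooth_ramp x\<bar> \<le> \<bar>x\<bar>"
  using smooth_step_range[of x] by (simp add: smooth_ramp_def abs_mult mult_left_le)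

lemma deriv_smooth_ramp_eq:
  shows "x \<le> 0 \<Longrightarrow> deriv smooth_ramp x = 0"
    and "x \<ge> 1 \<Longrightarrow> deriv smooth_ramp x = 1"
proof -
  have D: "continuous_on UNIV (deriv smooth_ramp)"
    by (intro smooth_continuous_on smooth_deriv smooth_smooth_ramp)
  have 0: "deriv smooth_ramp x = 0" if "x < 0" for x
    by (rule DERIV_imp_deriv, rule has_field_derivative_transform_within_open[OF DERIV_const, of "{..<0}"])
      (use that in \<open>auto simp: smooth_ramp_eq\<close>)
  have 1: "deriv smooth_ramp x = 1" if "x > 1" for x
    by (rule DERIV_imp_deriv, rule has_field_derivative_transform_within_open[OF DERIV_ident, of "{1<..}"])
      (use that in \<open>auto simp: smooth_ramp_eq\<close>)
  show "deriv smooth_ramp x = 0" if "x \<le> 0"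
  proof -
    \<comment> \<open>The endpoint lies in the closure of the open half-line and is covered by
      continuity of the derivative.\<close>
    have "deriv smooth_ramp ` closure {..<0} \<subseteq> {0}"
      using D by (intro image_closure_subset) (auto intro: continuous_on_subset simp: 0)
    then show ?thesis using that by auto
  qed
  show "deriv smooth_ramp x = 1" if "x \<ge> 1"
  proof -
    have "deriv smooth_ramp ` closure {1<..} \<subseteq> {1}"
      using D by (intro image_closure_subset) (auto intro: continuous_on_subset simp: 1)
    then show ?thesis using that by auto
  qed
qed

lemma bounded_deriv_smooth_ramp: "\<exists>B. \<forall>x. \<bar>deriv smooth_ramp x\<bar> \<le> B"
proof -
  have "bounded (deriv smooth_ramp ` {0..1})"
    by (intro compact_imp_bounded compact_continuous_image smooth_continuous_on smooth_deriv
        smooth_smooth_ramp) simp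
  then obtain B where B: "\<And>x. x \<in> {0..1} \<Longrightarrow> \<bar>deriv smooth_ramp x\<bar> \<le> B"
    unfolding bounded_iff by (metis image_eqI real_norm_def)
  have "\<bar>deriv smooth_ramp x\<bar> \<le> max B 1" for x
    using B[of x] deriv_smooth_ramp_eq[of x] by (cases "x \<in> {0..1}") auto
  then show ?thesis by blast
qed

lemma test_functionI:
  assumes "smooth f" and "\<And>x. \<bar>x\<bar> > R \<Longrightarrow> f x = 0"
  shows "test_function f"
proof -
  have "{t. f t \<noteq> 0} \<subseteq> {-R..R}"
    using assms(2) by (force simp: abs_le_iff not_less[symmetric])
  then have "bounded {t. f t \<noteq> 0}"
    using bounded_closed_interval bounded_subset by blast
  then show ?thesis
    using smooth_deriv_funpow[OF assms(1)]
    by (auto simp: test_function_def compact_closure)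
qed

lemma test_functionD:
  assumes "test_function \<phi>"
  shows "(\<phi> has_real_derivative deriv \<phi> t) (at t)"
    and "continuous_on S \<phi>" and "continuous_on S (deriv \<phi>)"
    and "\<exists>R. \<forall>x. \<bar>x\<bar> > R \<longrightarrow> \<phi> x = 0 \<and> deriv \<phi> x = 0"
proof -
  have D: "(deriv ^^ j) \<phi> field_differentiable (at t)" for j t
    using assms by (auto simp: test_function_def)
  show D0: "(\<phi> has_real_derivative deriv \<phi> t) (at t)" for t
    using D[of 0] by (simp add: DERIV_deriv_iff_field_differentiable)
  show "continuous_on S \<phi>"
    by (rule DERIV_continuous_on, rule has_field_derivative_at_within, rule D0)
  have D1: "(deriv \<phi> has_real_derivative deriv (deriv \<phi>) t) (at t)" for t
    using D[of 1] by (simp add: DERIV_deriv_iff_field_differentiable)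
  show "continuous_on S (deriv \<phi>)"
    by (rule DERIV_continuous_on, rule has_field_derivative_at_within, rule D1)
  have "bounded {t. \<phi> t \<noteq> 0}"
    using assms bounded_subset[OF _ closure_subset] by (auto simp: test_function_def dest: compact_imp_bounded)
  then obtain R where R: "\<And>x. \<phi> x \<noteq> 0 \<Longrightarrow> \<bar>x\<bar> \<le> R"
    by (auto simp: bounded_iff)
  have "deriv \<phi> x = 0" if "\<bar>x\<bar> > R" for x
  proof (rule DERIV_imp_deriv, rule has_field_derivative_transform_within_open[OF DERIV_const])
    show "open ({..<-R} \<union> {R<..})" and "x \<in> {..<-R} \<union> {R<..}"
      using that by auto
    show "0 = \<phi> y" if "y \<in> {..<-R} \<union> {R<..}" for y
      using R[of y] that by (cases "\<phi> y = 0") auto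
  qed
  then show "\<exists>R. \<forall>x. \<bar>x\<bar> > R \<longrightarrow> \<phi> x = 0 \<and> deriv \<phi> x = 0"
    using R by (meson not_le)
qed

subsection \<open>Weak derivatives on the line\<close>

text \<open>A Dynkin argument: the half-lines \<open>{..a}\<close> are stable under intersection and
  generate the Borel sets, so vanishing integrals over intervals spread to all Borel sets and force
  the integrand to vanish almost everywhere.\<close>

lemma AE_eq_0_if_integrals_eq_0:
  fixes f :: "real \<Rightarrow> real"
  assumes f: "\<And>t. f absolutely_integrable_on {0..t}"
    and 0: "\<And>t. 0 \<le> t \<Longrightarrow> integral {0..t} f = 0"
  shows "AE t in lebesgue. 0 \<le> t \<longrightarrow> f t = 0"
proof -
  have "AE t in lebesgue. t \<in> {0..real k} \<longrightarrow> f t = 0" for k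
  proof -
    define g where "g t = indicator {0..real k} t * f t" for t
    have g: "integrable lebesgue g"
      using f[of k] by (simp add: set_integrable_def g_def[abs_def])
    \<comment> \<open>Half-lines generate only the Borel sets, so the truncated function
      \<open>g\<close> is replaced by a Borel function equal to it almost everywhere.\<close>
    obtain h where h: "h \<in> borel_measurable lborel" and gh: "AE t in lborel. g t = h t"
      using completion_ex_borel_measurable_real[of g lborel] borel_measurable_integrable[OF g] by auto
    have gh': "AE t in lebesgue. g t = h t"
      using gh by (rule AE_completion)
    have "integrable lebesgue h"
      using g gh' h by (subst integrable_cong_AE[where g = g]) (auto intro: measurable_completion)
    then have hi: "integrable lborel h"
      using integrable_completion h by blast
    have hA: "set_integrable lborel A h" if "A \<in> sets borel" for A
      unfolding set_integrable_def using that by (intro integrable_mult_indicator hi) auto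
    have base: "(LINT t:{..a}|lborel. h t) = 0" for a
    proof -
      have "(LINT t:{..a}|lborel. h t) = (LINT t|lebesgue. indicator {..a} t *\<^sub>R h t)"
        unfolding set_lebesgue_integral_def using h by (intro integral_completion[symmetric]) auto
      also have "\<dots> = (LINT t|lebesgue. indicator {..a} t *\<^sub>R g t)"
        using gh' h borel_measurable_integrable[OF g]
        by (intro integral_cong_AE borel_measurable_scaleR borel_measurable_indicator)
          (auto intro: measurable_completion)
      \<comment> \<open>\<open>{..a}\<close> meets \<open>{0..k}\<close> in
        \<open>{0..min a k}\<close>, which is empty for negative \<open>a\<close>.\<close>
      also have "\<dots> = (LINT t:{0..min a k}|lebesgue. f t)"
        unfolding set_lebesgue_integral_def
        by (rule Bochner_Integration.integral_cong) (auto simp: g_def indicator_def)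
      also have "\<dots> = 0"
        using set_lebesgue_integral_eq_integral(2)[OF f] 0
        by (cases "min a k \<ge> 0") (auto simp: set_lebesgue_integral_def)
      finally show ?thesis .
    qed
    \<comment> \<open>The integral over the whole line is used for complements in the induction
      below.\<close>
    have tot: "(LINT t|lborel. h t) = 0"
    proof -
      have "(LINT t|lborel. h t) = (LINT t|lebesgue. h t)"
        using h by (intro integral_completion[symmetric])
      also have "\<dots> = (LINT t|lebesgue. g t)"
        using gh' h borel_measurable_integrable[OF g]
        by (intro integral_cong_AE) (auto intro: measurable_completion)
      also have "\<dots> = (LINT t:{0..k}|lebesgue. f t)"
        unfolding set_lebesgue_integral_def
        by (rule Bochner_Integration.integral_cong) (auto simp: g_def indicator_def)
      also have "\<dots> = 0"
        using set_lebesgue_integral_eq_integral(2)[OF f] 0 by auto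
      finally show ?thesis .
    qed
    have sets: "sets borel = sigma_sets UNIV (range (\<lambda>a::real. {..a}))"
      by (subst borel_eq_atMost) (simp add: sets_measure_of)
    have stable: "Int_stable (range (\<lambda>a::real. {..a}))"
      by (auto simp: Int_stable_def)
    have subset: "range (\<lambda>a::real. {..a}) \<subseteq> Pow UNIV"
      by simp
    have "(LINT t:A|lborel. h t) = 0" if "A \<in> sets borel" for A
      using stable subset that[unfolded sets]
    proof (induction A rule: sigma_sets_induct_disjoint)
      case (compl A)
      then have A: "A \<in> sets borel"
        by (simp add: sets)
      have "(LINT t:UNIV - A|lborel. h t) = (LINT t|lborel. h t - indicator A t *\<^sub>R h t)"
        unfolding set_lebesgue_integral_def
        by (intro Bochner_Integration.integral_cong) (auto simp: indicator_def)
      also have "\<dots> = (LINT t|lborel. h t) - (LINT t:A|lborel. h t)"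
        unfolding set_lebesgue_integral_def using hA[OF A] hi
        by (intro Bochner_Integration.integral_diff) (auto simp: set_integrable_def)
      finally have "(LINT t:UNIV - A|lborel. h t) = (LINT t|lborel. h t) - (LINT t:A|lborel. h t)" .
      then show ?case
        using tot compl by simp
    next
      case (union A)
      then have A: "A i \<in> sets borel" for i
        by (auto simp: sets)
      have "(LINT t:(\<Union>i. A i)|lborel. h t) = (\<Sum>i. (LINT t:A i|lborel. h t))"
        using A union(1) by (intro lebesgue_integral_countable_add hA) (auto simp: disjoint_family_on_def)
      then show ?case
        using union by simp
    next
      case (basic A)
      then show ?case
        using base by blast
    qed (simp add: set_lebesgue_integral_def)
    then have "AE t in lborel. h t = 0"
      by (intro sigma_finite_measure.density_zero[OF sigma_finite_lborel] hi) auto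
    with gh have "AE t in lborel. g t = 0"
      by eventually_elim simp
    then have "AE t in lebesgue. g t = 0"
      by (rule AE_completion)
    then show ?thesis
      by eventually_elim (auto simp: g_def)
  qed
  then have "AE t in lebesgue. \<forall>k. t \<in> {0..real k} \<longrightarrow> f t = 0"
    unfolding AE_all_countable by blast
  then show ?thesis
    by eventually_elim (metis atLeastAtMost_iff real_arch_simple)
qed

lemma absolutely_integrable_times_continuous:
  fixes f g :: "real \<Rightarrow> real"
  assumes "f absolutely_integrable_on {a..b}" and "continuous_on {a..b} g"
  shows "(\<lambda>x. f x * g x) absolutely_integrable_on {a..b}"
proof -
  have "bounded (g ` {a..b})"
    using assms by (intro compact_imp_bounded compact_continuous_image) auto
  moreover have "g \<in> borel_measurable (lebesgue_on {a..b})"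
    using assms by (intro continuous_imp_measurable_on_sets_lebesgue) auto
  ultimately have "(\<lambda>x. g x * f x) absolutely_integrable_on {a..b}"
    using assms by (intro absolutely_integrable_bounded_measurable_product_real) auto
  then show ?thesis
    by (simp add: mult.commute)
qed

text \<open>The derivative of the right-hand side is computed by hand, since \<open>g\<close> is merely integrable.\<close>

lemma integral_integral_eq:
  fixes g :: "real \<Rightarrow> real"
  assumes g: "\<And>t. g absolutely_integrable_on {0..t}" and "0 \<le> t"
  shows "integral {0..t} (\<lambda>s. integral {0..s} g) = integral {0..t} (\<lambda>x. g x * (t - x))"
proof -
  define Q where "Q t = integral {0..t} (\<lambda>x. g x * (t - x))" for t
  define G where "G s = integral {0..s} g" for s
  \<comment> \<open>\<open>W\<close> dominates the increments of \<open>G\<close> and is continuous;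
    it controls the error of the difference quotients of \<open>Q\<close>.\<close>
  define W where "W s = integral {0..s} (\<lambda>x. \<bar>g x\<bar>)" for s
  have gab: "g absolutely_integrable_on {a..b}" if "0 \<le> a" for a b
    using set_integrable_subset[OF g[of b]] that by auto
  have gi: "g integrable_on {a..b}" and gai: "(\<lambda>x. \<bar>g x\<bar>) integrable_on {a..b}"
    and gmi: "(\<lambda>x. g x * (c - x)) integrable_on {a..b}" if "0 \<le> a" for a b c
    using gab[OF that] absolutely_integrable_times_continuous[OF gab[OF that], where g = "\<lambda>x. c - x"]
    by (auto simp: absolutely_integrable_on_def continuous_on_op_minus)
  have Gd: "G v - G u = integral {u..v} g" and Wd: "W v - W u = integral {u..v} (\<lambda>x. \<bar>g x\<bar>)"
    if "0 \<le> u" "u \<le> v" for u v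
    using Henstock_Kurzweil_Integration.integral_combine[of 0 u v g]
      Henstock_Kurzweil_Integration.integral_combine[of 0 u v "\<lambda>x. \<bar>g x\<bar>"] that gi[of 0 v] gai[of 0 v]
    by (auto simp: G_def W_def)
  have Gle: "\<bar>G v - G u\<bar> \<le> W v - W u" if "0 \<le> u" "u \<le> v" for u v
    unfolding Gd[OF that] Wd[OF that]
    using Henstock_Kurzweil_Integration.integral_norm_bound_integral[of g "{u..v}" "\<lambda>x. \<bar>g x\<bar>"] gi gai that
    by auto
  \<comment> \<open>Changing the kernel on \<open>{0..u}\<close> from \<open>u - x\<close> to
    \<open>v - x\<close> contributes exactly \<open>(v - u) * G u\<close>; what remains is an
    integral over \<open>{u..v}\<close>, where the kernel is at most \<open>v - u\<close>.\<close>
  have est: "\<bar>Q v - Q u - (v - u) * G u\<bar> \<le> (v - u) * (W v - W u)" if uv: "0 \<le> u" "u \<le> v" for u v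
  proof -
    have "Q v = integral {0..u} (\<lambda>x. g x * (v - x)) + integral {u..v} (\<lambda>x. g x * (v - x))"
      unfolding Q_def
      using Henstock_Kurzweil_Integration.integral_combine[of 0 u v "\<lambda>x. g x * (v - x)"] uv gmi[of 0 v v]
      by auto
    also have "integral {0..u} (\<lambda>x. g x * (v - x)) = integral {0..u} (\<lambda>x. g x * (u - x) + (v - u) * g x)"
      by (simp add: algebra_simps)
    also have "\<dots> = Q u + (v - u) * G u"
      unfolding Q_def G_def using gmi[of 0 u u] gi[of 0 u]
      by (subst Henstock_Kurzweil_Integration.integral_add) (auto intro!: integrable_on_mult_right)
    finally have "Q v - Q u - (v - u) * G u = integral {u..v} (\<lambda>x. g x * (v - x))"
      by simp
    also have "\<bar>\<dots>\<bar> \<le> integral {u..v} (\<lambda>x. (v - u) * \<bar>g x\<bar>)"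
      unfolding real_norm_def[symmetric] using gmi[OF uv(1)] gai[OF uv(1)] uv
      by (intro Henstock_Kurzweil_Integration.integral_norm_bound_integral integrable_on_mult_right)
        (auto simp: abs_mult mult.commute intro!: mult_left_mono)
    also have "\<dots> = (v - u) * (W v - W u)"
      by (simp add: Wd[OF uv])
    finally show ?thesis .
  qed
  \<comment> \<open>For \<open>v < u\<close> the base point of the estimate is exchanged, which
    costs a second copy of the error; hence the factor 2.\<close>
  have est': "\<bar>Q v - Q u - (v - u) * G u\<bar> \<le> \<bar>v - u\<bar> * (2 * \<bar>W v - W u\<bar>)" if "0 \<le> u" "0 \<le> v" for u v
  proof (cases "u \<le> v")
    case True
    then show ?thesis
      using est[of u v] Gle[of u v] that by (auto simp: algebra_simps)
  next
    case False
    have "\<bar>Q v - Q u - (v - u) * G u\<bar> \<le> \<bar>Q u - Q v - (u - v) * G v\<bar> + \<bar>(u - v) * (G u - G v)\<bar>"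
      by (simp add: algebra_simps)
    also have "\<dots> \<le> (u - v) * (W u - W v) + (u - v) * (W u - W v)"
      using est[of v u] Gle[of v u] that False by (intro add_mono) (auto simp: abs_mult intro!: mult_left_mono)
    also have "\<dots> = \<bar>v - u\<bar> * (2 * \<bar>W v - W u\<bar>)"
    proof -
      have "\<bar>v - u\<bar> = u - v" "\<bar>W v - W u\<bar> = W u - W v"
        using Gle[of v u] False that by auto
      then show ?thesis by simp
    qed
    finally show ?thesis .
  qed
  have W: "continuous_on {0..t} W"
    unfolding W_def by (intro indefinite_integral_continuous_1 gai) simp
  have "(Q has_real_derivative G s) (at s within {0..t})" if s: "s \<in> {0..t}" for s
  proof -
    have "((\<lambda>y. (Q y - Q s) / (y - s) - G s) \<longlongrightarrow> 0) (at s within {0..t})"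
    proof (rule Lim_null_comparison)
      show "\<forall>\<^sub>F y in at s within {0..t}. norm ((Q y - Q s) / (y - s) - G s) \<le> 2 * \<bar>W y - W s\<bar>"
      proof (unfold eventually_at_filter, rule always_eventually, intro allI impI)
        fix y assume y: "y \<noteq> s" "y \<in> {0..t}"
        then have "(Q y - Q s) / (y - s) - G s = (Q y - Q s - (y - s) * G s) / (y - s)"
          by (simp add: field_simps)
        then have "norm ((Q y - Q s) / (y - s) - G s) = \<bar>Q y - Q s - (y - s) * G s\<bar> / \<bar>y - s\<bar>"
          by (simp only: real_norm_def abs_divide)
        also have "\<dots> \<le> 2 * \<bar>W y - W s\<bar>"
          using est'[of s y] y s by (simp add: divide_le_eq mult.commute)
        finally show "norm ((Q y - Q s) / (y - s) - G s) \<le> 2 * \<bar>W y - W s\<bar>" .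
      qed
      have "((\<lambda>y. 2 * \<bar>W y - W s\<bar>) \<longlongrightarrow> 2 * \<bar>W s - W s\<bar>) (at s within {0..t})"
        using W s by (intro tendsto_intros) (auto simp: continuous_on_def)
      then show "((\<lambda>y. 2 * \<bar>W y - W s\<bar>) \<longlongrightarrow> 0) (at s within {0..t})"
        by simp
    qed
    then have "((\<lambda>y. (Q y - Q s) / (y - s)) \<longlongrightarrow> G s) (at s within {0..t})"
      by (simp add: LIM_zero_iff)
    then show ?thesis
      by (simp add: has_field_derivative_iff)
  qed
  then have "(G has_integral (Q t - Q 0)) {0..t}"
    using \<open>0 \<le> t\<close> by (intro fundamental_theorem_of_calculus)
      (auto simp: has_real_derivative_iff_has_vector_derivative)
  then have "integral {0..t} G = Q t - Q 0"
    by (rule integral_unique)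
  then show ?thesis
    by (simp add: G_def[abs_def] Q_def)
qed


text \<open>Scalar form of \<open>L1_loc\<close>, as \<open>is_weak_derivative\<close> is of
  \<open>weak_derivative\<close>: the analysis is done one component at a time.\<close>

definition locally_integrable :: "(real \<Rightarrow> real) \<Rightarrow> bool" where
  "locally_integrable f \<longleftrightarrow> (\<forall>S. compact S \<longrightarrow> set_integrable lebesgue S f)"

definition is_weak_derivative :: "(real \<Rightarrow> real) \<Rightarrow> (real \<Rightarrow> real) \<Rightarrow> bool" where
  "is_weak_derivative f g \<longleftrightarrow> locally_integrable f \<and> locally_integrable g \<and>
     (\<forall>\<phi>. test_function \<phi> \<longrightarrow> (LINT t|lebesgue. f t * deriv \<phi> t) = - (LINT t|lebesgue. g t * \<phi> t))"

lemma locally_integrable_measurable: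
  assumes "locally_integrable f"
  shows "f \<in> borel_measurable lebesgue"
proof -
  have "(\<lambda>t. indicator {- real k..real k} t * f t) \<in> borel_measurable lebesgue" for k
    using assms by (auto simp: locally_integrable_def set_integrable_def dest: spec[of _ "{- real k..real k}"])
  moreover have "(\<lambda>k. indicator {- real k..real k} t * f t) \<longlonglongrightarrow> f t" for t
  proof (rule tendsto_eventually)
    obtain m where "\<bar>t\<bar> \<le> real m"
      using real_arch_simple by blast
    then show "\<forall>\<^sub>F k in sequentially. indicator {- real k..real k} t * f t = f t"
      by (intro eventually_sequentiallyI[of m]) (auto simp: indicator_def)
  qed
  ultimately show ?thesis
    by (rule borel_measurable_LIMSEQ_real[rotated])
qed

lemma integrable_times_bounded_support:
  assumes f: "locally_integrable f" and h: "h \<in> borel_measurable lebesgue"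
    and B: "\<And>t. \<bar>h t\<bar> \<le> B" and R: "\<And>t. \<bar>t\<bar> > R \<Longrightarrow> h t = 0"
  shows "integrable lebesgue (\<lambda>t. f t * h t)"
proof (rule Bochner_Integration.integrable_bound)
  show "integrable lebesgue (\<lambda>t. B * (indicator {-R..R} t * f t))"
    using f by (auto simp: locally_integrable_def set_integrable_def)
  show "(\<lambda>t. f t * h t) \<in> borel_measurable lebesgue"
    using locally_integrable_measurable[OF f] h by measurable
  show "AE t in lebesgue. norm (f t * h t) \<le> norm (B * (indicator {-R..R} t * f t))"
  proof (rule AE_I2)
    fix t
    show "norm (f t * h t) \<le> norm (B * (indicator {-R..R} t * f t))"
    proof (cases "\<bar>t\<bar> > R")
      case False
      have "\<bar>h t\<bar> \<le> \<bar>B\<bar>"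
        using B[of t] by linarith
      with False show ?thesis
        by (auto simp: abs_mult indicator_def mult.commute[of "\<bar>f t\<bar>"] intro!: mult_right_mono)
    qed (use R in simp)
  qed
qed

lemma integrable_times_test_function:
  assumes "locally_integrable f" and "test_function \<phi>"
  shows "integrable lebesgue (\<lambda>t. f t * \<phi> t)" and "integrable lebesgue (\<lambda>t. f t * deriv \<phi> t)"
proof -
  obtain R where R: "\<And>x. \<bar>x\<bar> > R \<Longrightarrow> \<phi> x = 0" "\<And>x. \<bar>x\<bar> > R \<Longrightarrow> deriv \<phi> x = 0"
    using test_functionD(4)[OF assms(2)] by blast
  have *: "integrable lebesgue (\<lambda>t. f t * h t)"
    if h: "continuous_on UNIV h" and R: "\<And>x. \<bar>x\<bar> > R \<Longrightarrow> h x = 0" for h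
  proof -
    have "bounded (h ` {-R..R})"
      using h by (intro compact_imp_bounded compact_continuous_image) (auto intro: continuous_on_subset)
    then obtain B where B: "\<And>t. t \<in> {-R..R} \<Longrightarrow> \<bar>h t\<bar> \<le> B"
      unfolding bounded_iff by (metis image_eqI real_norm_def)
    show ?thesis
    proof (rule integrable_times_bounded_support[OF assms(1) _ _ R])
      show "h \<in> borel_measurable lebesgue"
        using h by (intro measurable_completion) (simp add: borel_measurable_continuous_onI)
      show "\<bar>h t\<bar> \<le> max B 0" for t
        using B[of t] R[of t] by (cases "t \<in> {-R..R}") auto
    qed
  qed
  show "integrable lebesgue (\<lambda>t. f t * \<phi> t)" and "integrable lebesgue (\<lambda>t. f t * deriv \<phi> t)"
    by (intro * test_functionD(2,3)[OF assms(2)]; use R in blast)+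
qed

text \<open>Scaling argument and value by the same factor keeps the slope bounded uniformly in
  \<open>n\<close>, while the transition interval shrinks to the point 0.\<close>

definition scaled_ramp :: "nat \<Rightarrow> real \<Rightarrow> real" where
  "scaled_ramp n x = smooth_ramp (real (Suc n) * x) / real (Suc n)"

definition scaled_step :: "nat \<Rightarrow> real \<Rightarrow> real" where
  "scaled_step n x = deriv smooth_ramp (real (Suc n) * x)"

lemma smooth_scaled_ramp: "smooth (\<lambda>x. scaled_ramp n (x - b))"
proof -
  have "smooth (\<lambda>x. inverse (real (Suc n)) * smooth_ramp (real (Suc n) * x + (- real (Suc n) * b)))"
    by (intro smooth_intros(1,4) smooth_intros(6)[of smooth_ramp] smooth_smooth_ramp)
  then show ?thesis
    unfolding scaled_ramp_def[abs_def] by (simp add: field_simps)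
qed

lemma DERIV_scaled_ramp: "((\<lambda>x. scaled_ramp n (x - b)) has_real_derivative scaled_step n (x - b)) (at x)"
  unfolding scaled_ramp_def scaled_step_def
  by (auto intro!: derivative_eq_intros DERIV_chain2[OF smooth_DERIV[OF smooth_smooth_ramp]])

lemma scaled_ramp_eq:
  shows "x \<le> 0 \<Longrightarrow> scaled_ramp n x = 0" and "x \<ge> 1 \<Longrightarrow> scaled_ramp n x = x"
    and "x \<le> 0 \<Longrightarrow> scaled_step n x = 0" and "x \<ge> 1 \<Longrightarrow> scaled_step n x = 1"
proof -
  have 1: "1 \<le> real (Suc n) * x" if "x \<ge> 1"
    using mult_mono[of 1 "real (Suc n)" 1 x] that by simp
  have 0: "real (Suc n) * x \<le> 0" if "x \<le> 0"
    using that by (intro mult_nonneg_nonpos) auto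
  show "x \<le> 0 \<Longrightarrow> scaled_ramp n x = 0" "x \<ge> 1 \<Longrightarrow> scaled_ramp n x = x"
    "x \<le> 0 \<Longrightarrow> scaled_step n x = 0" "x \<ge> 1 \<Longrightarrow> scaled_step n x = 1"
    using 0 1 by (simp_all add: scaled_ramp_def scaled_step_def smooth_ramp_eq deriv_smooth_ramp_eq del: of_nat_Suc)
qed

lemma abs_scaled_ramp_le: "\<bar>scaled_ramp n x\<bar> \<le> \<bar>x\<bar>"
  using abs_smooth_ramp_le[of "real (Suc n) * x"]
  by (simp add: scaled_ramp_def abs_mult divide_le_eq mult.commute)

text \<open>Both sequences are eventually constant at each point: for \<open>x > 0\<close> as soon
  as \<open>Suc n * x\<close> reaches 1, otherwise from the start.\<close>

lemma scaled_ramp_tendsto: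
  shows "(\<lambda>n. scaled_ramp n x) \<longlonglongrightarrow> max 0 x"
    and "(\<lambda>n. scaled_step n x) \<longlonglongrightarrow> (if 0 < x then 1 else 0)"
proof -
  have "\<forall>\<^sub>F n in sequentially. scaled_ramp n x = max 0 x \<and> scaled_step n x = (if 0 < x then 1 else 0)"
  proof (cases "0 < x")
    case True
    obtain m where m: "inverse x \<le> real m"
      using real_arch_simple by blast
    show ?thesis
    proof (rule eventually_sequentiallyI[of m])
      fix n assume "m \<le> n"
      then have "inverse x \<le> real (Suc n)"
        using m by simp
      then have "1 \<le> real (Suc n) * x"
        using True by (simp add: field_simps)
      then show "scaled_ramp n x = max 0 x \<and> scaled_step n x = (if 0 < x then 1 else 0)"
        using True by (simp add: scaled_ramp_def scaled_step_def smooth_ramp_eq deriv_smooth_ramp_eq del: of_nat_Suc)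
    qed
  qed (simp add: scaled_ramp_eq)
  then show "(\<lambda>n. scaled_ramp n x) \<longlonglongrightarrow> max 0 x" "(\<lambda>n. scaled_step n x) \<longlonglongrightarrow> (if 0 < x then 1 else 0)"
    by (auto intro!: tendsto_eventually elim: eventually_mono)
qed

text \<open>The test functions \<open>(1 - t) \<rho>(x) - \<rho>(x - t) + t \<rho>(x - 1)\<close>, where \<open>\<rho>\<close> is a smoothed positive
  part, have compact support because the linear parts cancel for large \<open>x\<close>; their derivatives tend
  to the difference of the indicator of \<open>(0, t]\<close> and \<open>t\<close> times the indicator of \<open>(0, 1]\<close>.\<close>

lemma is_weak_derivative_integral_eq:
  assumes fg: "is_weak_derivative f g" and t: "0 \<le> t"
  shows "(LINT x|lebesgue. f x * (indicator {0<..t} x - t * indicator {0<..1} x)) =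
    (LINT x|lebesgue. g x * (indicator {0..t} x * (t - x) - t * (indicator {0..1} x * (1 - x))))"
proof -
  have f: "locally_integrable f" and g: "locally_integrable g"
    using fg by (auto simp: is_weak_derivative_def)
  note [measurable] = locally_integrable_measurable[OF f] locally_integrable_measurable[OF g]
  \<comment> \<open>Beyond \<open>t + 2\<close> all of \<open>x\<close>, \<open>x - t\<close> and
    \<open>x - 1\<close> exceed 1, so every ramp is in its linear range.\<close>
  define R where "R = t + 2"
  define \<phi> where "\<phi> n x = (1 - t) * scaled_ramp n (x - 0) + (- 1) * scaled_ramp n (x - t) + t * scaled_ramp n (x - 1)" for n x
  define \<phi>' where "\<phi>' n x = (1 - t) * scaled_step n (x - 0) + (- 1) * scaled_step n (x - t) + t * scaled_step n (x - 1)" for n x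
  obtain B where B: "\<bar>deriv smooth_ramp x\<bar> \<le> B" for x
    using bounded_deriv_smooth_ramp by blast
  \<comment> \<open>One constant above the bounds for values and slopes serves both uses of
    dominated convergence.\<close>
  define C where "C = (1 + t) * B + B + t * B + ((1 + t) * R + R + t * R)"
  have B0: "0 \<le> B"
    using B[of 0] by linarith
  have sm: "smooth (\<phi> n)" for n
    unfolding \<phi>_def[abs_def] by (intro smooth_intros(1,3,4) smooth_scaled_ramp)
  have D: "(\<phi> n has_real_derivative \<phi>' n x) (at x)" for n x
    unfolding \<phi>_def[abs_def] \<phi>'_def by (intro DERIV_add DERIV_cmult DERIV_scaled_ramp)
  then have der: "deriv (\<phi> n) = \<phi>' n" for n
    by (auto intro: DERIV_imp_deriv)
  \<comment> \<open>To the right of \<open>R\<close> the values cancel as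
    \<open>(1 - t) * x - (x - t) + t * (x - 1) = 0\<close> and the slopes as
    \<open>(1 - t) - 1 + t = 0\<close>.\<close>
  have supp: "\<phi> n x = 0" "\<phi>' n x = 0" if "x < 0 \<or> R < x" for n x
    using that t by (auto simp: \<phi>_def \<phi>'_def R_def scaled_ramp_eq algebra_simps)
  have test: "test_function (\<phi> n)" for n
    by (rule test_functionI[OF sm, of R]) (use t in \<open>auto simp: R_def intro!: supp\<close>)
  have meas [measurable]: "\<phi> n \<in> borel_measurable lebesgue" "\<phi>' n \<in> borel_measurable lebesgue" for n
    using smooth_continuous_on[OF sm[of n], of UNIV] smooth_continuous_on[OF smooth_deriv[OF sm[of n]], of UNIV]
    by (auto simp: der intro!: measurable_completion borel_measurable_continuous_onI)
  have "\<bar>scaled_step n x\<bar> \<le> B" for n x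
    unfolding scaled_step_def by (rule B)
  then have bd': "\<bar>\<phi>' n x\<bar> \<le> (1 + t) * B + B + t * B" for n x
    unfolding \<phi>'_def using t
    by (intro order.trans[OF abs_triangle_ineq] add_mono) (auto simp: abs_mult intro!: mult_mono)
  have bd: "\<bar>\<phi> n x\<bar> \<le> (1 + t) * R + R + t * R" for n x
  proof (cases "x < 0 \<or> R < x")
    case False
    then have "\<bar>scaled_ramp n (x - 0)\<bar> \<le> R" "\<bar>scaled_ramp n (x - t)\<bar> \<le> R" "\<bar>scaled_ramp n (x - 1)\<bar> \<le> R"
      using t abs_scaled_ramp_le[of n] by (auto simp: R_def intro!: order.trans[OF abs_scaled_ramp_le])
    then show ?thesis
      unfolding \<phi>_def using t
      by (intro order.trans[OF abs_triangle_ineq] add_mono) (auto simp: abs_mult intro!: mult_mono)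
  qed (use t in \<open>auto simp: supp R_def\<close>)
  have C: "\<bar>\<phi> n x\<bar> \<le> C" "\<bar>\<phi>' n x\<bar> \<le> C" for n x
    using bd[of n x] bd'[of n x] t B0 by (auto simp: C_def R_def intro: add_increasing add_increasing2)
  have lim: "(\<lambda>n. LINT x|lebesgue. h x * p n x) \<longlonglongrightarrow> (LINT x|lebesgue. h x * p' x)"
    if h: "locally_integrable h" and [measurable]: "\<And>n. p n \<in> borel_measurable lebesgue"
      and pC: "\<And>n x. \<bar>p n x\<bar> \<le> C" and p0: "\<And>n x. x < 0 \<or> R < x \<Longrightarrow> p n x = 0"
      and p': "\<And>x. (\<lambda>n. p n x) \<longlonglongrightarrow> p' x" for h p p'
  proof (rule integral_dominated_convergence)
    note [measurable] = locally_integrable_measurable[OF h]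
    have [measurable]: "p' \<in> borel_measurable lebesgue"
      by (rule borel_measurable_LIMSEQ_real[OF p']) simp
    show "(\<lambda>x. h x * p' x) \<in> borel_measurable lebesgue" "\<And>n. (\<lambda>x. h x * p n x) \<in> borel_measurable lebesgue"
      by measurable
    have "integrable lebesgue (\<lambda>x. h x * (C * indicator {0..R} x))"
    proof (rule integrable_times_bounded_support[OF h, where R = R and B = C])
      show "(\<lambda>x. C * indicator {0..R} x) \<in> borel_measurable lebesgue"
        by (intro borel_measurable_times borel_measurable_const borel_measurable_indicator) simp
    qed (use C(1)[of 0 0] in \<open>auto simp: indicator_def\<close>)
    then show "integrable lebesgue (\<lambda>x. \<bar>h x * (C * indicator {0..R} x)\<bar>)"
      by (rule integrable_abs)
    show "AE x in lebesgue. (\<lambda>n. h x * p n x) \<longlonglongrightarrow> h x * p' x"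
      by (intro AE_I2 tendsto_intros p')
    show "AE x in lebesgue. norm (h x * p n x) \<le> \<bar>h x * (C * indicator {0..R} x)\<bar>" for n
    proof (rule AE_I2)
      fix x
      show "norm (h x * p n x) \<le> \<bar>h x * (C * indicator {0..R} x)\<bar>"
        using pC[of n x] p0[of x n] by (cases "x < 0 \<or> R < x") (auto simp: abs_mult intro!: mult_left_mono)
    qed
  qed
  \<comment> \<open>\<open>\<phi>' n\<close> tends to \<open>\<chi>\<close> and
    \<open>\<phi> n\<close> to \<open>- \<tau>\<close>; this sign absorbs the minus in the
    definition of the weak derivative.\<close>
  define \<chi> where "\<chi> x = indicator {0<..t} x - t * indicator {0<..1} x" for x :: real
  define \<tau> where "\<tau> x = indicator {0..t} x * (t - x) - t * (indicator {0..1} x * (1 - x))" for x :: real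
  have l': "(\<lambda>n. \<phi>' n x) \<longlonglongrightarrow> \<chi> x" for x
  proof -
    have "(\<lambda>n. \<phi>' n x) \<longlonglongrightarrow> (1 - t) * (if 0 < x - 0 then 1 else 0) + (- 1) * (if 0 < x - t then 1 else 0)
        + t * (if 0 < x - 1 then 1 else 0)"
      unfolding \<phi>'_def by (intro tendsto_intros scaled_ramp_tendsto)
    moreover have "(1 - t) * (if 0 < x - 0 then 1 else 0) + (- 1) * (if 0 < x - t then 1 else 0)
        + t * (if 0 < x - 1 then 1 else 0) = \<chi> x"
      using t by (auto simp: \<chi>_def indicator_def)
    ultimately show ?thesis by simp
  qed
  have l: "(\<lambda>n. \<phi> n x) \<longlonglongrightarrow> - \<tau> x" for x
  proof -
    have "(\<lambda>n. \<phi> n x) \<longlonglongrightarrow> (1 - t) * max 0 (x - 0) + (- 1) * max 0 (x - t) + t * max 0 (x - 1)"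
      unfolding \<phi>_def by (intro tendsto_intros scaled_ramp_tendsto)
    moreover have "(1 - t) * max 0 (x - 0) + (- 1) * max 0 (x - t) + t * max 0 (x - 1) = - \<tau> x"
      using t by (auto simp: \<tau>_def indicator_def max_def algebra_simps)
    ultimately show ?thesis by metis
  qed
  have "(\<lambda>n. LINT x|lebesgue. f x * \<phi>' n x) \<longlonglongrightarrow> (LINT x|lebesgue. f x * \<chi> x)"
    by (rule lim[OF f _ C(2) supp(2) l']) auto
  moreover have "(\<lambda>n. LINT x|lebesgue. g x * \<phi> n x) \<longlonglongrightarrow> (LINT x|lebesgue. g x * (- \<tau> x))"
    by (rule lim[OF g _ C(1) supp(1) l]) auto
  then have "(\<lambda>n. - (LINT x|lebesgue. g x * \<phi> n x)) \<longlonglongrightarrow> - (LINT x|lebesgue. g x * (- \<tau> x))"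
    by (rule tendsto_minus)
  moreover have "(LINT x|lebesgue. f x * \<phi>' n x) = - (LINT x|lebesgue. g x * \<phi> n x)" for n
    using fg test[of n] by (auto simp: is_weak_derivative_def der[symmetric])
  ultimately have "(LINT x|lebesgue. f x * \<chi> x) = - (LINT x|lebesgue. g x * (- \<tau> x))"
    by (auto intro: LIMSEQ_unique)
  also have "\<dots> = (LINT x|lebesgue. g x * \<tau> x)"
    by simp
  finally show ?thesis
    by (simp only: \<chi>_def \<tau>_def)
qed

text \<open>The preceding identity says that \<open>P t - Q t\<close> is linear in \<open>t\<close>,
  and \<open>integral_integral_eq\<close> makes \<open>Q\<close> the primitive of \<open>G\<close>.
  So \<open>f - G - c\<close> has integral 0 over every \<open>{0..t}\<close>.\<close>

lemma is_weak_derivative_AE_eq_integral: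
  assumes fg: "is_weak_derivative f g"
  obtains c where "AE t in lebesgue. 0 \<le> t \<longrightarrow> f t = c + integral {0..t} g"
proof -
  have f: "locally_integrable f" and g: "locally_integrable g"
    using fg by (auto simp: is_weak_derivative_def)
  have fi: "f absolutely_integrable_on {0..t}" and gi: "g absolutely_integrable_on {0..t}" for t
    using f g by (auto simp: locally_integrable_def)
  have qi: "(\<lambda>x. g x * (t - x)) absolutely_integrable_on {0..t}" for t
    by (intro absolutely_integrable_times_continuous gi continuous_intros)
  define P where "P t = integral {0..t} f" for t
  define Q where "Q t = integral {0..t} (\<lambda>x. g x * (t - x))" for t
  \<comment> \<open>The limit of \<open>scaled_step\<close> vanishes at 0, so the identity has
    \<open>{0<..t}\<close> in place of \<open>{0..t}\<close>; the difference is a null set.\<close>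
  have 0: "AE x in lebesgue. x \<noteq> (0::real)"
    by (rule AE_completion) (rule AE_lborel_singleton)
  have P: "P t = (LINT x|lebesgue. f x * indicator {0<..t} x)" "integrable lebesgue (\<lambda>x. f x * indicator {0<..t} x)" for t
  proof -
    have i: "integrable lebesgue (\<lambda>x. f x * indicator {0..t} x)"
      using fi[of t] by (simp add: set_integrable_def mult.commute)
    show i': "integrable lebesgue (\<lambda>x. f x * indicator {0<..t} x)"
      using Bochner_Integration.integrable_mult_indicator[OF _ i, of "{0<..t}"]
      by (rule Bochner_Integration.integrable_cong[THEN iffD1, rotated 2]) (auto simp: indicator_def)
    have "P t = (LINT x|lebesgue. f x * indicator {0..t} x)"
      using set_lebesgue_integral_eq_integral(2)[OF fi[of t]]
      by (simp add: P_def set_lebesgue_integral_def mult.commute)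
    also have "\<dots> = (LINT x|lebesgue. f x * indicator {0<..t} x)"
      using i i' 0 by (intro integral_cong_AE) (auto simp: indicator_def elim!: eventually_mono)
    finally show "P t = (LINT x|lebesgue. f x * indicator {0<..t} x)" .
  qed
  have Q: "Q t = (LINT x|lebesgue. g x * (indicator {0..t} x * (t - x)))"
    "integrable lebesgue (\<lambda>x. g x * (indicator {0..t} x * (t - x)))" for t
    using set_lebesgue_integral_eq_integral(2)[OF qi[of t]] qi[of t]
    by (auto simp: Q_def set_lebesgue_integral_def set_integrable_def algebra_simps)
  define c where "c = P 1 - Q 1"
  have PQ: "P t - Q t = c * t" if "0 \<le> t" for t
  proof -
    have "P t - t * P 1 = (LINT x|lebesgue. f x * indicator {0<..t} x - t * (f x * indicator {0<..1} x))"
      using P by simp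
    also have "\<dots> = (LINT x|lebesgue. g x * (indicator {0..t} x * (t - x)) - t * (g x * (indicator {0..1} x * (1 - x))))"
      using is_weak_derivative_integral_eq[OF fg that] by (simp add: right_diff_distrib mult.left_commute)
    also have "\<dots> = Q t - t * Q 1"
      using Q by simp
    finally show ?thesis
      by (simp add: c_def algebra_simps)
  qed
  define G where "G t = integral {0..t} g" for t
  have Gc: "continuous_on {0..t} G" for t
    unfolding G_def using gi by (intro indefinite_integral_continuous_1) (simp add: absolutely_integrable_on_def)
  then have Ga: "G absolutely_integrable_on {0..t}" for t
    using absolutely_integrable_continuous_real by blast
  have "AE t in lebesgue. 0 \<le> t \<longrightarrow> f t - (G t + c) = 0"
  proof (rule AE_eq_0_if_integrals_eq_0)
    show "(\<lambda>t. f t - (G t + c)) absolutely_integrable_on {0..t}" for t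
      using fi Ga by (intro set_integral_diff set_integral_add) (auto intro: absolutely_integrable_continuous_real)
    show "integral {0..t} (\<lambda>t. f t - (G t + c)) = 0" if "0 \<le> t" for t
    proof -
      have i: "f integrable_on {0..t}" "G integrable_on {0..t}"
        using fi Ga by (auto simp: absolutely_integrable_on_def)
      have "integral {0..t} (\<lambda>t. f t - (G t + c)) = P t - (integral {0..t} G + c * t)"
        using i that Henstock_Kurzweil_Integration.integral_add[of G "{0..t}" "\<lambda>_. c"]
          Henstock_Kurzweil_Integration.integrable_add[of G "{0..t}" "\<lambda>_. c"] integrable_const_ivl[of c 0 t]
        by (subst Henstock_Kurzweil_Integration.integral_diff) (auto simp: P_def mult.commute)
      also have "integral {0..t} G = Q t"
        unfolding G_def Q_def by (rule integral_integral_eq[OF gi that])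
      finally show ?thesis
        using PQ[OF that] by simp
    qed
  qed
  then show ?thesis
    by (intro that[of c]) (auto simp: G_def elim!: eventually_mono)
qed

subsection \<open>Polynomials acting on sequences and stable differential equations\<close>

text \<open>This is p(S) c for the left shift S. On a sequence of derivatives S acts as d/dt, on k
  -> M A^k v as multiplication of v by A, so one operator expresses both p(d/dt) f and M p(A)
  v.\<close>

definition poly_shift :: "'a::comm_ring_1 poly \<Rightarrow> (nat \<Rightarrow> 'a) \<Rightarrow> nat \<Rightarrow> 'a" where
  "poly_shift p c j = (\<Sum>i\<le>degree p. coeff p i * c (i + j))"

lemma poly_shift_0 [simp]: "poly_shift 0 c = (\<lambda>_. 0)"
  by (simp add: poly_shift_def fun_eq_iff)

lemma poly_shift_pCons: "poly_shift (pCons a p) c j = a * c j + poly_shift p c (Suc j)"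
proof (cases "p = 0")
  case False
  then show ?thesis
    by (simp add: poly_shift_def sum.atMost_Suc_shift del: sum.atMost_Suc)
qed (simp add: poly_shift_def)

lemma poly_shift_zero_fun: "(\<And>i. c i = 0) \<Longrightarrow> poly_shift p c j = 0"
  by (simp add: poly_shift_def)

lemma poly_shift_shift: "poly_shift p (\<lambda>k. c (k + m)) j = poly_shift p c (j + m)"
  by (simp add: poly_shift_def add.assoc)

lemma poly_shift_add_fun: "poly_shift p (\<lambda>k. c k + d k) j = poly_shift p c j + poly_shift p d j"
  by (simp add: poly_shift_def algebra_simps sum.distrib)

lemma poly_shift_cmult_fun: "poly_shift p (\<lambda>k. b * c k) j = b * poly_shift p c j"
  by (simp add: poly_shift_def sum_distrib_left mult.left_commute)

lemma poly_shift_sum_fun: "poly_shift p (\<lambda>k. \<Sum>x\<in>X. c x k) j = (\<Sum>x\<in>X. poly_shift p (c x) j)"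
  unfolding poly_shift_def by (simp add: sum_distrib_left sum.swap[of _ X])

lemma poly_shift_add: "poly_shift (p + q) c j = poly_shift p c j + poly_shift q c j"
proof (induction p q arbitrary: j rule: poly_induct2)
  case (pCons a p b q)
  then show ?case
    by (simp add: poly_shift_pCons algebra_simps)
qed simp

lemma poly_shift_smult: "poly_shift (Polynomial.smult b p) c j = b * poly_shift p c j"
proof (induction p arbitrary: j)
  case (pCons a p)
  then show ?case
    by (simp add: poly_shift_pCons algebra_simps)
qed simp

lemma poly_shift_mult: "poly_shift (p * q) c j = poly_shift p (poly_shift q c) j"
proof (induction p arbitrary: j)
  case (pCons a p)
  then show ?case
    by (simp add: poly_shift_pCons poly_shift_add poly_shift_smult)
qed simp

lemma poly_shift_mult_eq_0:
  assumes "\<And>j. poly_shift q c j = 0"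
  shows "poly_shift (p * q) c j = 0"
  by (simp add: poly_shift_mult poly_shift_zero_fun assms)

lemma poly_shift_of_real:
  fixes p :: "real poly"
  shows "poly_shift (map_poly complex_of_real p) (\<lambda>k. complex_of_real (c k)) j = complex_of_real (poly_shift p c j)"
  by (simp add: poly_shift_def coeff_map_poly degree_map_poly)

text \<open>The sequence is real, so taking real parts of the coefficients commutes with the sum.
  This leads from a complex quotient of a real polynomial back to real polynomials.\<close>

lemma poly_shift_Re:
  fixes p :: "complex poly"
  shows "poly_shift (map_poly Re p) c j = Re (poly_shift p (\<lambda>k. complex_of_real (c k)) j)"
proof (induction p arbitrary: j)
  case (pCons a p)
  then show ?case
    by (simp add: poly_shift_pCons map_poly_pCons)
qed simp

lemma poly_shift_Im:
  fixes p :: "complex poly"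
  shows "poly_shift (map_poly Im p) c j = Im (poly_shift p (\<lambda>k. complex_of_real (c k)) j)"
proof (induction p arbitrary: j)
  case (pCons a p)
  then show ?case
    by (simp add: poly_shift_pCons map_poly_pCons)
qed simp

text \<open>The leading coefficient is nonzero, so the relation is a recurrence in which
  \<open>degree p\<close> consecutive terms determine the next.\<close>

lemma poly_shift_eq_0_initial:
  fixes p :: "'a::{comm_ring_1, ring_no_zero_divisors} poly"
  assumes "p \<noteq> 0" and ann: "\<And>j. poly_shift p c j = 0" and init: "\<And>j. j < degree p \<Longrightarrow> c j = 0"
  shows "c j = 0"
proof (induction j rule: less_induct)
  case (less j)
  show ?case
  proof (cases "j < degree p")
    case False
    then have "0 = (\<Sum>i\<le>degree p. coeff p i * c (i + (j - degree p)))"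
      using ann[of "j - degree p"] by (simp add: poly_shift_def)
    also have "\<dots> = (\<Sum>i\<in>{degree p}. coeff p i * c (i + (j - degree p)))"
      using False less by (intro sum.mono_neutral_right) (auto intro!: less)
    also have "\<dots> = lead_coeff p * c j"
      using False by simp
    finally show ?thesis
      using \<open>p \<noteq> 0\<close> by simp
  qed (rule init)
qed

text \<open>Variation of constants as an inequality: \<open>h\<close> removes the factor exp(l t),
  and the mean value inequality compares its growth with that of
  \<open>e / 2 * exp (m * t)\<close>.\<close>

lemma tendsto_0_linear_ode:
  fixes f g :: "real \<Rightarrow> complex"
  assumes f: "\<And>t. 0 < t \<Longrightarrow> (f has_vector_derivative l * f t + g t) (at t)"
    and g: "(g \<longlongrightarrow> 0) at_top" and l: "Re l < 0"
  shows "(f \<longlongrightarrow> 0) at_top"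
proof (rule tendstoI)
  fix e :: real assume "0 < e"
  define m where "m = - Re l"
  have m: "0 < m"
    using l by (simp add: m_def)
  \<comment> \<open>With this threshold the derivative of \<open>h\<close> stays below that of
    \<open>e / 2 * exp (m * t)\<close>.\<close>
  have "\<forall>\<^sub>F t in at_top. norm (g t) < e / 2 * m"
    using tendstoD[OF g, of "e / 2 * m"] \<open>0 < e\<close> m by simp
  then obtain s0 where s0: "\<And>t. s0 \<le> t \<Longrightarrow> norm (g t) < e / 2 * m"
    by (auto simp: eventually_at_top_linorder)
  \<comment> \<open>The equation for \<open>f\<close> is available only at positive times.\<close>
  define s where "s = max 1 s0"
  define h where "h t = exp (of_real t * (- l)) * f t" for t
  have h: "(h has_vector_derivative exp (of_real t * (- l)) * g t) (at t)" if "0 < t" for t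
    unfolding h_def
    by (rule derivative_eq_intros exp_scaleR_has_vector_derivative_right[of "- l" t, unfolded scaleR_conv_of_real] f that refl)+
      (simp add: algebra_simps)
  have "norm (h t - h s) \<le> e / 2 * exp (m * t) - e / 2 * exp (m * s)" if "s < t" for t
  proof (rule differentiable_bound_general[OF that])
    show "continuous_on {s..t} h"
      by (intro continuous_at_imp_continuous_on ballI, rule has_vector_derivative_continuous, rule h)
        (auto simp: s_def)
    show "continuous_on {s..t} (\<lambda>x. e / 2 * exp (m * x))"
      by (intro continuous_intros)
    fix x assume x: "s < x" "x < t"
    then show "(h has_vector_derivative exp (of_real x * (- l)) * g x) (at x)"
      by (intro h) (auto simp: s_def)
    show "((\<lambda>x. e / 2 * exp (m * x)) has_vector_derivative e / 2 * m * exp (m * x)) (at x)"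
      unfolding has_real_derivative_iff_has_vector_derivative[symmetric]
      by (auto intro!: derivative_eq_intros)
    have "norm (exp (of_real x * (- l)) * g x) = exp (m * x) * norm (g x)"
      by (simp add: norm_mult m_def mult.commute)
    also have "\<dots> \<le> exp (m * x) * (e / 2 * m)"
      using s0[of x] x by (intro mult_left_mono) (auto simp: s_def)
    finally show "norm (exp (of_real x * (- l)) * g x) \<le> e / 2 * m * exp (m * x)"
      by (simp add: mult.commute)
  qed
  then have bound: "norm (f t) \<le> exp (- m * t) * norm (h s) + e / 2" if "s < t" for t
  proof -
    have "f t = exp (of_real t * l) * h t"
      by (simp add: h_def mult.assoc[symmetric] exp_add[symmetric])
    then have "norm (f t) = exp (- m * t) * norm (h t)"
      by (simp add: norm_mult m_def mult.commute)
    also have "norm (h t) \<le> norm (h s) + e / 2 * exp (m * t)"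
      using norm_triangle_sub[of "h t" "h s"] \<open>s < t \<Longrightarrow> norm (h t - h s) \<le> _\<close>[OF that] \<open>0 < e\<close>
      by (smt (verit) exp_gt_zero mult_pos_pos half_gt_zero)
    also have "exp (- m * t) * (norm (h s) + e / 2 * exp (m * t)) = exp (- m * t) * norm (h s) + e / 2"
      by (simp add: algebra_simps exp_add[symmetric] flip: exp_minus)
    finally show ?thesis
      by simp
  qed
  have "((\<lambda>t. exp (- m * t) * norm (h s)) \<longlongrightarrow> 0 * norm (h s)) at_top"
  proof (intro tendsto_intros filterlim_compose[OF exp_at_bot])
    show "filterlim (\<lambda>t. - m * t) at_bot at_top"
      using m by (intro filterlim_tendsto_neg_mult_at_bot[OF tendsto_const] filterlim_ident) auto
  qed
  then have "\<forall>\<^sub>F t in at_top. exp (- m * t) * norm (h s) < e / 2"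
    using \<open>0 < e\<close> by (intro order_tendstoD) auto
  then show "\<forall>\<^sub>F t in at_top. dist (f t) 0 < e"
    using eventually_gt_at_top[of s]
  proof eventually_elim
    case (elim t)
    then show ?case
      using bound[of t] by simp
  qed
qed

text \<open>\<open>f t k\<close> stands for the k-th derivative, so the hypothesis is p(d/dt) f = 0.
  For a root \<open>l\<close>, the function f' - l f solves the equation of the quotient and decays
  by induction; \<open>tendsto_0_linear_ode\<close> passes the decay on to f.\<close>

lemma tendsto_0_if_stable_poly_shift:
  fixes p :: "complex poly" and f :: "real \<Rightarrow> nat \<Rightarrow> complex"
  assumes "p \<noteq> 0" and "\<And>l. poly p l = 0 \<Longrightarrow> Re l < 0"
    and "\<And>t k. 0 < t \<Longrightarrow> ((\<lambda>t. f t k) has_vector_derivative f t (Suc k)) (at t)"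
    and "\<And>t k. 0 < t \<Longrightarrow> poly_shift p (f t) k = 0"
  shows "((\<lambda>t. f t 0) \<longlongrightarrow> 0) at_top"
  using assms
proof (induction "degree p" arbitrary: p f)
  case 0
  then obtain c where c: "p = [:c:]" "c \<noteq> 0"
    by (metis degree_eq_zeroE pCons_0_0)
  have "f t 0 = 0" if "0 < t" for t
    using "0.prems"(4)[OF that, of 0] c by (simp add: poly_shift_pCons)
  then show ?case
    by (intro tendsto_eventually eventually_mono[OF eventually_gt_at_top[of 0]])
next
  case (Suc d)
  have "\<not> constant (poly p)"
    using Suc.hyps(2) by (simp add: constant_degree)
  then obtain l where l: "poly p l = 0"
    using fundamental_theorem_of_algebra by blast
  then obtain q where q: "p = [:- l, 1:] * q"
    by (auto simp: poly_eq_0_iff_dvd elim: dvdE)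
  have "q \<noteq> 0"
    using Suc.prems(1) q by auto
  define g where "g t = poly_shift [:- l, 1:] (f t)" for t
  have g_eq: "g t k = f t (Suc k) - l * f t k" for t k
    by (simp add: g_def poly_shift_pCons)
  have "((\<lambda>t. g t 0) \<longlongrightarrow> 0) at_top"
  proof (rule Suc.hyps(1))
    show "d = degree q"
      using Suc.hyps(2) \<open>q \<noteq> 0\<close> unfolding q by (subst (asm) degree_mult_eq) auto
    show "q \<noteq> 0" by fact
    show "Re k < 0" if "poly q k = 0" for k
      using Suc.prems(2)[of k] that q by simp
    show "((\<lambda>t. g t k) has_vector_derivative g t (Suc k)) (at t)" if "0 < t" for t k
      unfolding g_eq
      by (intro has_vector_derivative_diff has_vector_derivative_mult_right Suc.prems(3) that)
    show "poly_shift q (g t) k = 0" if "0 < t" for t k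
      using Suc.prems(4)[OF that, of k] by (simp add: g_def q mult.commute[of _ q] poly_shift_mult del: mult_pCons_left mult_pCons_right)
  qed
  then show ?case
  proof (rule tendsto_0_linear_ode[rotated])
    show "Re l < 0"
      using Suc.prems(2) l .
    show "((\<lambda>t. f t 0) has_vector_derivative l * f t 0 + g t 0) (at t)" if "0 < t" for t
      using Suc.prems(3)[OF that, of 0] by (simp add: g_eq)
  qed
qed

subsection \<open>Weak differential equations\<close>

lemma locally_integrable_continuous:
  assumes "continuous_on UNIV f"
  shows "locally_integrable f"
  unfolding locally_integrable_def
proof (intro allI impI)
  fix S :: "real set" assume S: "compact S"
  have "integrable lborel (\<lambda>x. indicator S x *\<^sub>R f x)"
    using S assms by (intro borel_integrable_compact) (auto intro: continuous_on_subset)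
  then show "set_integrable lebesgue S f"
    unfolding set_integrable_def
    by (subst integrable_completion) (auto dest: borel_measurable_integrable)
qed

text \<open>Integration by parts: \<open>f t * \<phi> t\<close> vanishes at both ends of an interval
  that contains the support of \<open>\<phi>\<close>.\<close>

lemma is_weak_derivative_continuous:
  assumes f: "\<And>t. (f has_real_derivative f' t) (at t)" and f': "continuous_on UNIV f'"
  shows "is_weak_derivative f f'"
proof -
  have fc: "continuous_on UNIV f"
    by (rule DERIV_continuous_on, rule has_field_derivative_at_within, rule f)
  have li: "locally_integrable f" "locally_integrable f'"
    using fc f' by (auto intro: locally_integrable_continuous)
  have "(LINT t|lebesgue. f t * deriv \<phi> t) = - (LINT t|lebesgue. f' t * \<phi> t)" if \<phi>: "test_function \<phi>" for \<phi>
  proof -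
    obtain R where R: "\<And>x. \<bar>x\<bar> > R \<Longrightarrow> \<phi> x = 0" "\<And>x. \<bar>x\<bar> > R \<Longrightarrow> deriv \<phi> x = 0"
      using test_functionD(4)[OF \<phi>] by blast
    \<comment> \<open>Positive and strictly above \<open>R\<close>: the interval is nonempty and
      \<open>\<phi>\<close> vanishes at its ends.\<close>
    define r where "r = \<bar>R\<bar> + 1"
    define g where "g t = f t * deriv \<phi> t + f' t * \<phi> t" for t
    have gi: "integrable lebesgue g"
      unfolding g_def using li \<phi> by (intro Bochner_Integration.integrable_add integrable_times_test_function)
    have "indicator {-r..r} t *\<^sub>R g t = g t" for t
      using R[of t] by (cases "\<bar>t\<bar> > R") (auto simp: g_def r_def indicator_def)
    then have gr: "(\<lambda>t. indicator {-r..r} t *\<^sub>R g t) = g"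
      by (rule ext)
    have D: "((\<lambda>t. f t * \<phi> t) has_real_derivative g t) (at t)" for t
      unfolding g_def by (rule derivative_eq_intros f test_functionD(1)[OF \<phi>] refl)+ simp
    have "(g has_integral f r * \<phi> r - f (- r) * \<phi> (- r)) {-r..r}"
    proof (rule fundamental_theorem_of_calculus)
      show "((\<lambda>t. f t * \<phi> t) has_vector_derivative g t) (at t within {-r..r})" for t
        using D by (simp add: has_real_derivative_iff_has_vector_derivative has_vector_derivative_at_within)
    qed (simp add: r_def)
    moreover have "\<phi> r = 0" "\<phi> (- r) = 0"
      by (intro R; simp add: r_def)+
    ultimately have "integral {-r..r} g = 0"
      by (simp add: integral_unique)
    moreover have "set_integrable lebesgue {-r..r} g"
      using gi unfolding set_integrable_def gr .
    ultimately have "(LINT t|lebesgue. g t) = 0"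
      using set_lebesgue_integral_eq_integral(2)[of "{-r..r}" g] by (simp only: set_lebesgue_integral_def gr)
    then show ?thesis
      unfolding g_def using integrable_times_test_function[OF li(1) \<phi>] integrable_times_test_function[OF li(2) \<phi>]
      by (subst (asm) Bochner_Integration.integral_add) auto
  qed
  with li show ?thesis
    by (simp add: is_weak_derivative_def)
qed

lemma locally_integrable_add:
  "locally_integrable f \<Longrightarrow> locally_integrable g \<Longrightarrow> locally_integrable (\<lambda>t. f t + g t)"
  by (auto simp: locally_integrable_def intro: set_integral_add)

lemma locally_integrable_cmult: "locally_integrable f \<Longrightarrow> locally_integrable (\<lambda>t. c * f t)"
  by (auto simp: locally_integrable_def)

lemma is_weak_derivative_add:
  assumes "is_weak_derivative f f'" and "is_weak_derivative g g'"
  shows "is_weak_derivative (\<lambda>t. f t + g t) (\<lambda>t. f' t + g' t)"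
  using assms
  by (auto simp: is_weak_derivative_def locally_integrable_add distrib_right integrable_times_test_function)

lemma is_weak_derivative_cmult:
  assumes "is_weak_derivative f f'"
  shows "is_weak_derivative (\<lambda>t. c * f t) (\<lambda>t. c * f' t)"
  using assms by (auto simp: is_weak_derivative_def locally_integrable_cmult mult.assoc)

lemma is_weak_derivative_sum:
  assumes "\<And>i. i \<in> I \<Longrightarrow> is_weak_derivative (f i) (f' i)"
  shows "is_weak_derivative (\<lambda>t. \<Sum>i\<in>I. f i t) (\<lambda>t. \<Sum>i\<in>I. f' i t)"
  using assms
proof (induction I rule: infinite_finite_induct)
  case (insert i I)
  then show ?case
    by (simp add: is_weak_derivative_add)
qed (auto intro!: is_weak_derivative_continuous)

lemma locally_integrable_AE_cong:
  assumes f: "locally_integrable f" and g: "g \<in> borel_measurable lebesgue"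
    and fg: "AE t in lebesgue. f t = g t"
  shows "locally_integrable g"
  unfolding locally_integrable_def set_integrable_def
proof (intro allI impI)
  fix S :: "real set" assume S: "compact S"
  note [measurable] = locally_integrable_measurable[OF f] g
  have [measurable]: "S \<in> sets lebesgue"
    using S by (simp add: compact_imp_closed)
  have "integrable lebesgue (\<lambda>x. indicator S x *\<^sub>R f x)"
    using f S by (simp add: locally_integrable_def set_integrable_def)
  then show "integrable lebesgue (\<lambda>x. indicator S x *\<^sub>R g x)"
    by (rule integrable_cong_AE_imp) (use fg in auto)
qed

lemma is_weak_derivative_AE_cong:
  assumes f: "is_weak_derivative f f'" and g: "g \<in> borel_measurable lebesgue"
    and fg: "AE t in lebesgue. f' t = g t"
  shows "is_weak_derivative f g"
proof -
  have li: "locally_integrable f" "locally_integrable f'"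
    using f by (auto simp: is_weak_derivative_def)
  then have li': "locally_integrable g"
    using locally_integrable_AE_cong[OF _ g fg] by blast
  have "(LINT t|lebesgue. f' t * \<phi> t) = (LINT t|lebesgue. g t * \<phi> t)" if "test_function \<phi>" for \<phi>
    using borel_measurable_integrable[OF integrable_times_test_function(1)[OF li(2) that]]
      borel_measurable_integrable[OF integrable_times_test_function(1)[OF li' that]]
    by (rule integral_cong_AE) (use fg in auto)
  then show ?thesis
    using f li li' by (simp add: is_weak_derivative_def)
qed

lemma integral_cong_AE_absolutely_integrable:
  fixes f g :: "real \<Rightarrow> real"
  assumes f: "f absolutely_integrable_on S" and g: "g absolutely_integrable_on S"
    and fg: "AE x in lebesgue. x \<in> S \<longrightarrow> f x = g x"
  shows "integral S f = integral S g"
proof -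
  have "(LINT x:S|lebesgue. f x) = (LINT x:S|lebesgue. g x)"
    unfolding set_lebesgue_integral_def
    using f g fg by (intro integral_cong_AE) (auto simp: set_integrable_def indicator_def
        dest: borel_measurable_integrable elim!: eventually_mono)
  then show ?thesis
    using f g by (simp add: set_lebesgue_integral_eq_integral(2))
qed

text \<open>Regularity is gained in stages: each \<open>e k\<close> has a continuous version
  \<open>E k\<close>; inserting these under the integral makes \<open>E k\<close> differentiable;
  the derivatives are again combinations of the \<open>E k\<close>, so they can be differentiated in
  turn. Eliminating all functions but the first leaves a(d/dt) E_0 = 0.\<close>

lemma weak_ode_tendsto_0:
  fixes e :: "nat \<Rightarrow> real \<Rightarrow> real" and a :: "real poly"
  assumes a: "lead_coeff a = 1" and d: "degree a = d" "0 < d"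
    and stable: "\<And>l. poly (map_poly complex_of_real a) l = 0 \<Longrightarrow> Re l < 0"
    and ed: "\<And>t. e d t = 0"
    and e: "\<And>k. k < d \<Longrightarrow> is_weak_derivative (e k) (\<lambda>t. e (Suc k) t - coeff a (d - Suc k) * e 0 t)"
  obtains E where "AE t in lebesgue. 0 \<le> t \<longrightarrow> e 0 t = E t" and "(E \<longlongrightarrow> 0) at_top"
proof -
  define b where "b k = coeff a (d - Suc k)" for k
  define e' where "e' k t = e (Suc k) t - b k * e 0 t" for k t
  have e': "is_weak_derivative (e k) (e' k)" if "k < d" for k
    using e[OF that] by (simp add: e'_def[abs_def] b_def)
  have "\<exists>c. AE t in lebesgue. 0 \<le> t \<longrightarrow> e k t = c + integral {0..t} (e' k)" if "k < d" for k
    using is_weak_derivative_AE_eq_integral[OF e'[OF that]] by metis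
  then obtain c where c: "\<And>k. k < d \<Longrightarrow> AE t in lebesgue. 0 \<le> t \<longrightarrow> e k t = c k + integral {0..t} (e' k)"
    by metis
  \<comment> \<open>The value 0 at index \<open>d\<close> matches \<open>e d = 0\<close> and gives
    the equation for \<open>k = d - 1\<close> the form of the others.\<close>
  define E where "E k t = (if k < d then c k + integral {0..t} (e' k) else 0)" for k t
  have eE: "AE t in lebesgue. 0 \<le> t \<longrightarrow> e k t = E k t" if "k \<le> d" for k
  proof (cases "k < d")
    case True
    then show ?thesis
      using c[OF True] by (simp add: E_def)
  next
    case False
    then show ?thesis
      using that ed by (simp add: E_def)
  qed
  have ei: "e' k absolutely_integrable_on {0..t}" if "k < d" for k t
    using e'[OF that] by (auto simp: is_weak_derivative_def locally_integrable_def)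
  have Ec: "continuous_on {0..t} (E k)" for k t
    using set_lebesgue_integral_eq_integral(1)[OF ei]
    by (cases "k < d") (auto simp: E_def[abs_def] intro!: continuous_intros indefinite_integral_continuous_1)
  have E': "((\<lambda>t. E k t) has_real_derivative E (Suc k) t - b k * E 0 t) (at t)" if k: "k < d" and t: "0 < t" for k t
  proof -
    let ?g = "\<lambda>t. E (Suc k) t - b k * E 0 t"
    have "AE t in lebesgue. 0 \<le> t \<longrightarrow> e' k t = ?g t"
      using eE[of "Suc k"] eE[of 0] k by (auto simp: e'_def)
    then have "AE x in lebesgue. x \<in> {0..s} \<longrightarrow> e' k x = ?g x" for s
      by eventually_elim auto
    then have int: "integral {0..s} (e' k) = integral {0..s} ?g" for s
      by (intro integral_cong_AE_absolutely_integrable ei[OF k] absolutely_integrable_continuous_real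
          continuous_intros Ec)
    \<comment> \<open>The interval reaches to \<open>t + 1\<close> so that \<open>t\<close> is
      interior and the derivative within it is the full one.\<close>
    have "((\<lambda>s. c k + integral {0..s} ?g) has_real_derivative 0 + ?g t) (at t within {0..t + 1})"
      by (intro DERIV_add DERIV_const integral_has_real_derivative)
        (use t in \<open>auto intro!: continuous_intros Ec\<close>)
    then have "((\<lambda>s. c k + integral {0..s} ?g) has_real_derivative ?g t) (at t)"
      using t at_within_Icc_at[of 0 t "t + 1"] by simp
    then show ?thesis
      using k by (simp add: E_def[of k] int)
  qed
  \<comment> \<open>For positive times \<open>F j k\<close> is the j-th derivative of
    \<open>E k\<close>, obtained by applying the right-hand side of the system j times.\<close>
  define F where "F j = ((\<lambda>G k t. if k < d then G (Suc k) t - b k * G 0 t else 0) ^^ j) E" for j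
  have F0: "F 0 = E" and FS: "F (Suc j) k t = (if k < d then F j (Suc k) t - b k * F j 0 t else 0)" for j k t
    by (simp_all add: F_def)
  have F': "((\<lambda>t. F j k t) has_real_derivative F (Suc j) k t) (at t)" if "0 < t" for j k t
  proof (induction j arbitrary: k)
    case 0
    show ?case
      using E'[OF _ that, of k] by (cases "k < d") (auto simp: F0 FS E_def[abs_def])
  next
    case (Suc j)
    show ?case
    proof (cases "k < d")
      case True
      have "((\<lambda>t. F j (Suc k) t - b k * F j 0 t) has_real_derivative F (Suc j) (Suc k) t - b k * F (Suc j) 0 t) (at t)"
        by (intro DERIV_diff DERIV_cmult Suc.IH)
      then show ?thesis
        using True by (simp add: FS[abs_def])
    qed (simp add: FS[abs_def])
  qed
  \<comment> \<open>Elimination: \<open>E k\<close> is the sum over i <= k of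
    \<open>coeff a (d - k + i)\<close> times the i-th derivative of \<open>E 0\<close>. At
    \<open>k = d\<close> all coefficients of \<open>a\<close> occur, and the sum is
    \<open>E d\<close>, that is 0.\<close>
  have Fsum: "(\<Sum>i\<le>k. coeff a (d - k + i) * F (i + j) 0 t) = F j k t" if "k \<le> d" for j k t
    using that
  proof (induction k arbitrary: j)
    case 0
    then show ?case
      using a d by simp
  next
    case (Suc k)
    have "(\<Sum>i\<le>Suc k. coeff a (d - Suc k + i) * F (i + j) 0 t) =
        b k * F j 0 t + (\<Sum>i\<le>k. coeff a (d - k + i) * F (i + Suc j) 0 t)"
      using Suc.prems by (subst sum.atMost_Suc_shift) (simp add: b_def Suc_diff_Suc[symmetric])
    also have "(\<Sum>i\<le>k. coeff a (d - k + i) * F (i + Suc j) 0 t) = F (Suc j) k t"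
      using Suc.IH[of "Suc j"] Suc.prems by simp
    also have "b k * F j 0 t + F (Suc j) k t = F j (Suc k) t"
      using FS[of j k t] Suc.prems by simp
    finally show ?case .
  qed
  have Fd: "F j d t = 0" for j t
    by (cases j) (simp_all only: F0 FS E_def less_irrefl if_False)
  have "((\<lambda>t. complex_of_real (F 0 0 t)) \<longlongrightarrow> 0) at_top"
  proof (rule tendsto_0_if_stable_poly_shift[where p = "map_poly complex_of_real a" and f = "\<lambda>t k. complex_of_real (F k 0 t)"])
    show "map_poly complex_of_real a \<noteq> 0"
      using a by (auto simp: map_poly_eq_0_iff)
    show "Re l < 0" if "poly (map_poly complex_of_real a) l = 0" for l
      using stable that .
    show "((\<lambda>t. complex_of_real (F k 0 t)) has_vector_derivative complex_of_real (F (Suc k) 0 t)) (at t)" if "0 < t" for t k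
      using F'[OF that, of k 0]
      by (intro has_vector_derivative_of_real) (simp add: has_real_derivative_iff_has_vector_derivative)
    show "poly_shift (map_poly complex_of_real a) (\<lambda>k. complex_of_real (F k 0 t)) k = 0" for t k
    proof -
      have "poly_shift a (\<lambda>k. F k 0 t) k = 0"
        using Fsum[of d k t] Fd[of k t] d(1) by (simp add: poly_shift_def)
      then show ?thesis
        by (simp add: poly_shift_of_real)
    qed
  qed
  then have "((\<lambda>t. E 0 t) \<longlongrightarrow> 0) at_top"
    unfolding F0 using tendsto_of_real_iff[of "E 0" 0 at_top, where 'a = complex] by simp
  with eE[of 0] show ?thesis
    by (intro that) auto
qed

section \<open>Exponential series with geometrically bounded coefficients\<close>

lemma exp_series_summable:
  fixes c :: "nat \<Rightarrow> real"
  assumes bnd: "\<And>k. \<bar>c k\<bar> \<le> B * R ^ k"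
  shows "summable (\<lambda>k. c k / fact k * t ^ k)"
proof (rule summable_comparison_test')
  show "summable (\<lambda>k. B * ((R * \<bar>t\<bar>) ^ k /\<^sub>R fact k))"
    by (intro summable_mult summable_exp_generic)
  show "norm (c k / fact k * t ^ k) \<le> B * ((R * \<bar>t\<bar>) ^ k /\<^sub>R fact k)" for k
  proof -
    have "norm (c k / fact k * t ^ k) = \<bar>c k\<bar> * (\<bar>t\<bar> ^ k / fact k)"
      by (simp add: abs_mult power_abs)
    also have "\<dots> \<le> B * R ^ k * (\<bar>t\<bar> ^ k / fact k)"
      by (intro mult_right_mono bnd) simp
    finally show ?thesis
      by (simp add: power_mult_distrib field_simps)
  qed
qed

text \<open>Termwise differentiation shifts \<open>c\<close>: the factor \<open>Suc k\<close> from
  \<open>diffs\<close> cancels against \<open>fact (Suc k)\<close>.\<close>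

lemma exp_series_DERIV:
  fixes c :: "nat \<Rightarrow> real"
  assumes bnd: "\<And>k. \<bar>c k\<bar> \<le> B * R ^ k"
  shows "((\<lambda>t. \<Sum>k. c k / fact k * t ^ k) has_real_derivative (\<Sum>k. c (Suc k) / fact k * t ^ k)) (at t)"
proof -
  have d: "diffs (\<lambda>k. c k / fact k) = (\<lambda>k. c (Suc k) / fact k)"
    by (auto simp: diffs_def fun_eq_iff field_simps simp del: of_nat_Suc)
  have "((\<lambda>t. \<Sum>k. c k / fact k * t ^ k) has_real_derivative (\<Sum>k. diffs (\<lambda>k. c k / fact k) k * t ^ k)) (at t)"
    by (rule termdiffs_strong_converges_everywhere) (rule exp_series_summable[where c = c, OF bnd])
  then show ?thesis
    by (simp only: d)
qed

subsection \<open>Powers of a matrix and spans of functionals\<close>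

lemma mult_mat_vec_nth:
  assumes "M \<in> carrier_mat r n" and "v \<in> carrier_vec n" and "i < r"
  shows "(M *\<^sub>v v) $ i = (\<Sum>s<n. M $$ (i, s) * v $ s)"
  using assms by (auto simp: scalar_prod_def atLeast0LessThan intro!: sum.cong)

text \<open>Pairs are flattened to \<open>i * b + j\<close>, both for the entries of powers of a
  matrix and for the blocks of the estimator state.\<close>

lemma mult_add_less:
  assumes "i < a" and "j < b"
  shows "i * b + j < a * (b::nat)"
proof -
  have "i * b + j < Suc i * b"
    using assms by simp
  also have "\<dots> \<le> a * b"
    using assms by (intro mult_le_mono1) simp
  finally show ?thesis .
qed

lemma pow_mat_add:
  assumes "A \<in> carrier_mat n n"
  shows "A ^\<^sub>m (j + k) = A ^\<^sub>m j * A ^\<^sub>m k"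
proof (induction k)
  case 0
  then show ?case
    using assms by simp
next
  case (Suc k)
  have "A ^\<^sub>m (j + Suc k) = (A ^\<^sub>m j * A ^\<^sub>m k) * A"
    using Suc by simp
  also have "\<dots> = A ^\<^sub>m j * (A ^\<^sub>m k * A)"
    using assms by (intro assoc_mult_mat) auto
  finally show ?case
    by simp
qed

lemma pow_mat_add_mult_vec:
  assumes "A \<in> carrier_mat n n" and "v \<in> carrier_vec n"
  shows "A ^\<^sub>m (j + k) *\<^sub>v v = A ^\<^sub>m j *\<^sub>v (A ^\<^sub>m k *\<^sub>v v)"
  using assms by (simp add: pow_mat_add[OF assms(1)] assoc_mult_mat_vec[of _ n n _ n])

lemma pow_mat_Suc_mult_vec:
  assumes "A \<in> carrier_mat n n" and "v \<in> carrier_vec n"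
  shows "A ^\<^sub>m Suc k *\<^sub>v v = A *\<^sub>v (A ^\<^sub>m k *\<^sub>v v)"
  using pow_mat_add_mult_vec[OF assms, of 1 k] assms(1) by simp

lemma pow_mat_mult_vec_carrier:
  assumes "A \<in> carrier_mat n n" and "v \<in> carrier_vec n"
  shows "A ^\<^sub>m k *\<^sub>v v \<in> carrier_vec n"
  by (rule mult_mat_vec_carrier[OF pow_carrier_mat[OF assms(1)] assms(2)])

text \<open>The vector on the left is \<open>p(A) A\<^sup>m v\<close>.\<close>

lemma poly_shift_mult_mat_vec:
  fixes A :: "'a::comm_ring_1 mat"
  assumes A: "A \<in> carrier_mat n n" and M: "M \<in> carrier_mat r n" and v: "v \<in> carrier_vec n" and l: "l < r"
  shows "(M *\<^sub>v (A ^\<^sub>m j *\<^sub>v vec n (\<lambda>i. poly_shift p (\<lambda>k. (A ^\<^sub>m k *\<^sub>v v) $ i) m))) $ l =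
    poly_shift p (\<lambda>k. (M *\<^sub>v (A ^\<^sub>m k *\<^sub>v v)) $ l) (j + m)"
proof -
  let ?M = "M * A ^\<^sub>m j"
  have M': "?M \<in> carrier_mat r n"
    using A M by (intro mult_carrier_mat[where n = n] pow_carrier_mat) auto
  note Akv = pow_mat_mult_vec_carrier[OF A v]
  have assoc: "?M *\<^sub>v w = M *\<^sub>v (A ^\<^sub>m j *\<^sub>v w)" if "w \<in> carrier_vec n" for w
    using A M that by (intro assoc_mult_mat_vec[of _ r n _ n] pow_carrier_mat)
  have "(M *\<^sub>v (A ^\<^sub>m j *\<^sub>v vec n (\<lambda>i. poly_shift p (\<lambda>k. (A ^\<^sub>m k *\<^sub>v v) $ i) m))) $ l
      = (\<Sum>s<n. ?M $$ (l, s) * poly_shift p (\<lambda>k. (A ^\<^sub>m k *\<^sub>v v) $ s) m)"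
    by (subst assoc[symmetric]) (simp_all add: mult_mat_vec_nth[OF M' _ l])
  also have "\<dots> = poly_shift p (\<lambda>k. \<Sum>s<n. ?M $$ (l, s) * (A ^\<^sub>m k *\<^sub>v v) $ s) m"
    by (simp add: poly_shift_sum_fun poly_shift_cmult_fun)
  also have "\<dots> = poly_shift p (\<lambda>k. (?M *\<^sub>v (A ^\<^sub>m k *\<^sub>v v)) $ l) m"
    by (simp add: mult_mat_vec_nth[OF M' Akv l])
  also have "\<dots> = poly_shift p (\<lambda>k. (M *\<^sub>v (A ^\<^sub>m (k + j) *\<^sub>v v)) $ l) m"
    by (simp add: assoc[OF Akv] pow_mat_add_mult_vec[OF A v, symmetric] add.commute)
  also have "\<dots> = poly_shift p (\<lambda>k. (M *\<^sub>v (A ^\<^sub>m k *\<^sub>v v)) $ l) (m + j)"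
    by (rule poly_shift_shift)
  finally show ?thesis
    by (simp add: add.commute)
qed

text \<open>The first \<open>n\<^sup>2 + 1\<close> powers of a matrix are linearly dependent.\<close>

lemma annihilating_poly_exists:
  fixes A :: "'a::idom mat"
  assumes A: "A \<in> carrier_mat n n"
  obtains p where "p \<noteq> 0"
    and "\<And>r M v l j. M \<in> carrier_mat r n \<Longrightarrow> v \<in> carrier_vec n \<Longrightarrow> l < r \<Longrightarrow>
      poly_shift p (\<lambda>k. (M *\<^sub>v (A ^\<^sub>m k *\<^sub>v v)) $ l) j = 0"
proof -
  define N where "N = n * n + 1"
  \<comment> \<open>Column \<open>k\<close> lists the entries of \<open>A ^\<^sub>m k\<close>. The
    last row is zero, so this square matrix is singular, and a kernel vector supplies the
    coefficients of \<open>p\<close>.\<close>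
  define E where "E = mat N N (\<lambda>(s, k). if s < n * n then (A ^\<^sub>m k) $$ (s div n, s mod n) else 0)"
  have E: "E \<in> carrier_mat N N"
    by (simp add: E_def)
  have "det E = (\<Sum>k<N. E $$ (n * n, k) * cofactor E (n * n) k)"
    by (rule laplace_expansion_row[OF E]) (simp add: N_def)
  then have "det E = 0"
    by (simp add: E_def N_def)
  then obtain c where c: "c \<in> carrier_vec N" "c \<noteq> 0\<^sub>v N" "E *\<^sub>v c = 0\<^sub>v N"
    using det_0_iff_vec_prod_zero[OF E] by blast
  define p where "p = (\<Sum>k<N. monom (c $ k) k)"
  have coeff: "coeff p k = (if k < N then c $ k else 0)" for k
    by (simp add: p_def coeff_sum if_distrib cong: if_cong)
  have shift: "poly_shift p f j = (\<Sum>k<N. c $ k * f (k + j))" for f j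
  proof -
    have "poly_shift p f j = (\<Sum>k\<in>{..degree p} \<union> {..<N}. coeff p k * f (k + j))"
      unfolding poly_shift_def by (intro sum.mono_neutral_left) (auto simp: coeff_eq_0)
    also have "\<dots> = (\<Sum>k<N. coeff p k * f (k + j))"
      by (intro sum.mono_neutral_right) (auto simp: coeff)
    finally show ?thesis
      by (simp add: coeff)
  qed
  have entry: "(\<Sum>k<N. c $ k * (A ^\<^sub>m k) $$ (i, i')) = 0" if "i < n" "i' < n" for i i'
  proof -
    have lt: "i * n + i' < n * n"
      using that by (rule mult_add_less)
    then have "0 = (E *\<^sub>v c) $ (i * n + i')"
      using c(3) by (simp add: N_def)
    also have "\<dots> = (\<Sum>k<N. E $$ (i * n + i', k) * c $ k)"
      using lt by (intro mult_mat_vec_nth[OF E c(1)]) (simp add: N_def)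
    also have "\<dots> = (\<Sum>k<N. c $ k * (A ^\<^sub>m k) $$ (i, i'))"
      using lt that by (intro sum.cong) (auto simp: E_def N_def mult.commute)
    finally show ?thesis ..
  qed
  show ?thesis
  proof (rule that)
    show "p \<noteq> 0"
    proof
      assume "p = 0"
      then have "c = 0\<^sub>v N"
        using coeff c(1) by (intro eq_vecI) (auto, metis coeff_0)
      with c(2) show False ..
    qed
    fix r :: nat and M :: "'a mat" and v :: "'a vec" and l j :: nat
    assume M: "M \<in> carrier_mat r n" and v: "v \<in> carrier_vec n" and l: "l < r"
    note Ajv = pow_mat_mult_vec_carrier[OF A v, of j]
    have "poly_shift p (\<lambda>k. (A ^\<^sub>m k *\<^sub>v v) $ i) j = 0" if i: "i < n" for i
    proof -
      have "poly_shift p (\<lambda>k. (A ^\<^sub>m k *\<^sub>v v) $ i) j =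
          (\<Sum>k<N. c $ k * (A ^\<^sub>m k *\<^sub>v (A ^\<^sub>m j *\<^sub>v v)) $ i)"
        by (simp add: shift pow_mat_add_mult_vec[OF A v])
      also have "\<dots> = (\<Sum>k<N. \<Sum>s<n. c $ k * (A ^\<^sub>m k) $$ (i, s) * (A ^\<^sub>m j *\<^sub>v v) $ s)"
        by (simp add: mult_mat_vec_nth[OF pow_carrier_mat[OF A] Ajv i] sum_distrib_left mult.assoc)
      also have "\<dots> = (\<Sum>s<n. (\<Sum>k<N. c $ k * (A ^\<^sub>m k) $$ (i, s)) * (A ^\<^sub>m j *\<^sub>v v) $ s)"
        by (subst sum.swap) (simp add: sum_distrib_right)
      finally show ?thesis
        by (simp add: entry[OF i])
    qed
    \<comment> \<open>This vector is p(A) A^j v; once it vanishes, so does its image under any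
      \<open>M\<close>.\<close>
    then have "vec n (\<lambda>i. poly_shift p (\<lambda>k. (A ^\<^sub>m k *\<^sub>v v) $ i) j) = 0\<^sub>v n"
      by (intro eq_vecI) auto
    then have "(M *\<^sub>v (A ^\<^sub>m 0 *\<^sub>v 0\<^sub>v n)) $ l = poly_shift p (\<lambda>k. (M *\<^sub>v (A ^\<^sub>m k *\<^sub>v v)) $ l) (0 + j)"
      using poly_shift_mult_mat_vec[OF A M v l, of 0 p j] by metis
    then show "poly_shift p (\<lambda>k. (M *\<^sub>v (A ^\<^sub>m k *\<^sub>v v)) $ l) j = 0"
      using A M l by simp
  qed
qed

text \<open>Induction on the functionals: on the kernel of one of them the others suffice, and a
  vector outside that kernel fixes the missing coefficient.\<close>

lemma functional_in_span:
  fixes f :: "'i \<Rightarrow> 'a::field vec \<Rightarrow> 'a" and S :: "'a vec set"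
  assumes "finite I"
    and closed: "\<And>v w c. v \<in> S \<Longrightarrow> w \<in> S \<Longrightarrow> v + c \<cdot>\<^sub>v w \<in> S"
    and f: "\<And>i v w c. i \<in> I \<Longrightarrow> v \<in> S \<Longrightarrow> w \<in> S \<Longrightarrow> f i (v + c \<cdot>\<^sub>v w) = f i v + c * f i w"
    and g: "\<And>v w c. v \<in> S \<Longrightarrow> w \<in> S \<Longrightarrow> g (v + c \<cdot>\<^sub>v w) = g v + c * g w"
    and ker: "\<And>v. v \<in> S \<Longrightarrow> (\<And>i. i \<in> I \<Longrightarrow> f i v = 0) \<Longrightarrow> g v = 0"
  shows "\<exists>y. \<forall>v\<in>S. g v = (\<Sum>i\<in>I. y i * f i v)"
  using assms
proof (induction I arbitrary: S rule: finite_induct)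
  case empty
  then show ?case
    by simp
next
  case (insert i I)
  define S' where "S' = {v \<in> S. f i v = 0}"
  have "\<exists>y. \<forall>v\<in>S'. g v = (\<Sum>i\<in>I. y i * f i v)"
  proof (rule insert.IH)
    show "g v = 0" if "v \<in> S'" "\<And>j. j \<in> I \<Longrightarrow> f j v = 0" for v
      using insert.prems(4)[of v] that by (auto simp: S'_def)
  qed (use insert.prems in \<open>auto simp: S'_def\<close>)
  then obtain y where y: "\<And>v. v \<in> S' \<Longrightarrow> g v = (\<Sum>i\<in>I. y i * f i v)"
    by blast
  show ?case
  proof (cases "\<exists>w\<in>S. f i w \<noteq> 0")
    case False
    then have "S' = S"
      by (auto simp: S'_def)
    with False y insert.hyps show ?thesis
      by (intro exI[of _ y]) auto
  next
    case True
    then obtain w where w: "w \<in> S" "f i w \<noteq> 0"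
      by blast
    \<comment> \<open>Chosen so that the identity holds at \<open>w\<close>.\<close>
    define b where "b = (g w - (\<Sum>j\<in>I. y j * f j w)) / f i w"
    have "g v = b * f i v + (\<Sum>j\<in>I. y j * f j v)" if v: "v \<in> S" for v
    proof -
      \<comment> \<open>Moves \<open>v\<close> along \<open>w\<close> into the kernel of
        \<open>f i\<close>.\<close>
      define c where "c = - (f i v / f i w)"
      have "v + c \<cdot>\<^sub>v w \<in> S'"
        using insert.prems(1,2) v w by (auto simp: S'_def c_def)
      then have "g (v + c \<cdot>\<^sub>v w) = (\<Sum>j\<in>I. y j * f j (v + c \<cdot>\<^sub>v w))"
        by (rule y)
      then have "g v + c * g w = (\<Sum>j\<in>I. y j * f j v) + c * (\<Sum>j\<in>I. y j * f j w)"
        using insert.prems(2,3) v w by (simp add: algebra_simps sum.distrib sum_distrib_left)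
      then show ?thesis
        using w(2) by (simp add: b_def c_def field_simps)
    qed
    then show ?thesis
      using insert.hyps
      by (intro exI[of _ "y(i := b)"]) (auto intro!: sum.cong)
  qed
qed

subsection \<open>The unobservable subspace\<close>

text \<open>Quantifying over all powers makes invariance under polynomials in \<open>A\<close>
  immediate; the reduction to finitely many powers is made in
  \<open>output_injection_exists\<close>.\<close>

definition unobservable :: "real mat \<Rightarrow> real mat \<Rightarrow> real vec set" where
  "unobservable A C = {v \<in> carrier_vec (dim_row A). \<forall>j. \<forall>i<dim_row C. (C *\<^sub>v (A ^\<^sub>m j *\<^sub>v v)) $ i = 0}"

text \<open>Here \<open>c\<close> consists of the derivatives at \<open>0\<close> of the function that decays; for \<open>c k = K A\<^sup>k v\<close>
  this function is \<open>t \<mapsto> K e\<^sup>t\<^sup>A v\<close>.\<close>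

definition decays :: "(nat \<Rightarrow> real) \<Rightarrow> bool" where
  "decays c \<longleftrightarrow> (\<forall>\<epsilon>>0. \<exists>T. AE t in lebesgue. T \<le> t \<longrightarrow> \<bar>\<Sum>k. c k / fact k * t ^ k\<bar> < \<epsilon>)"

text \<open>The series sums to exp(l t) z_0, whose modulus stays at least that of z_0 for t >= 0 if
  Re l >= 0.\<close>

lemma Re_neg_if_decays:
  assumes l: "\<And>k. z (Suc k) = l * z k" and z0: "z 0 \<noteq> 0"
    and Re: "decays (\<lambda>k. Re (z k))" and Im: "decays (\<lambda>k. Im (z k))"
  shows "Re l < 0"
proof (rule ccontr)
  assume neg: "\<not> Re l < 0"
  have z: "z k = l ^ k * z 0" for k
    by (induction k) (simp_all add: l)
  have sums: "(\<lambda>k. z k / fact k * of_real t ^ k) sums (exp (l * of_real t) * z 0)" for t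
  proof -
    have "(\<lambda>k. (l * of_real t) ^ k /\<^sub>R fact k * z 0) sums (exp (l * of_real t) * z 0)"
      by (intro sums_mult2 exp_converges)
    also have "(\<lambda>k. (l * of_real t) ^ k /\<^sub>R fact k * z 0) = (\<lambda>k. z k / fact k * of_real t ^ k)"
    proof
      show "(l * of_real t) ^ k /\<^sub>R fact k * z 0 = z k / fact k * of_real t ^ k" for k
        using z[of k] by (simp add: scaleR_conv_of_real power_mult_distrib divide_inverse)
    qed
    finally show ?thesis .
  qed
  have Re_z: "(\<Sum>k. Re (z k) / fact k * t ^ k) = Re (exp (l * of_real t) * z 0)"
    and Im_z: "(\<Sum>k. Im (z k) / fact k * t ^ k) = Im (exp (l * of_real t) * z 0)" for t
  proof -
    have *: "z k / fact k * of_real t ^ k = z k * of_real (t ^ k / fact k)" for k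
      by simp
    have "(\<lambda>k. Re (z k * of_real (t ^ k / fact k))) sums Re (exp (l * of_real t) * z 0)"
      "(\<lambda>k. Im (z k * of_real (t ^ k / fact k))) sums Im (exp (l * of_real t) * z 0)"
      using sums_Re[OF sums[of t]] sums_Im[OF sums[of t]] unfolding * .
    moreover have "Re (w * of_real x) = Re w * x" "Im (w * of_real x) = Im w * x" for w x
      by simp_all
    ultimately show "(\<Sum>k. Re (z k) / fact k * t ^ k) = Re (exp (l * of_real t) * z 0)"
      "(\<Sum>k. Im (z k) / fact k * t ^ k) = Im (exp (l * of_real t) * z 0)"
      by (simp_all only: sums_iff times_divide_eq_left times_divide_eq_right)
  qed
  \<comment> \<open>Half the modulus for each of the real and the imaginary part.\<close>
  define e where "e = norm (z 0) / 2"
  have "e > 0"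
    using z0 by (simp add: e_def)
  then obtain T1 T2 where
    T: "AE t in lebesgue. T1 \<le> t \<longrightarrow> \<bar>Re (exp (l * of_real t) * z 0)\<bar> < e"
      "AE t in lebesgue. T2 \<le> t \<longrightarrow> \<bar>Im (exp (l * of_real t) * z 0)\<bar> < e"
    using Re Im unfolding decays_def Re_z Im_z by meson
  define T where "T = max 0 (max T1 T2)"
  \<comment> \<open>The bounds hold only almost everywhere; the contradiction is that an interval of
    length 1 would be a null set.\<close>
  have "AE t in lebesgue. \<not> (t \<in> {T..T + 1})"
    using T
  proof eventually_elim
    case (elim t)
    show ?case
    proof
      assume t: "t \<in> {T..T + 1}"
      have "norm (z 0) \<le> exp (Re l * t) * norm (z 0)"
        using t neg by (simp add: mult_le_cancel_right1 T_def)
      also have "\<dots> = norm (exp (l * of_real t) * z 0)"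
        by (simp add: norm_mult)
      also have "\<dots> \<le> \<bar>Re (exp (l * of_real t) * z 0)\<bar> + \<bar>Im (exp (l * of_real t) * z 0)\<bar>"
        by (rule cmod_le)
      also have "\<dots> < norm (z 0)"
        using elim t by (auto simp: T_def e_def)
      finally show False
        by simp
    qed
  qed
  then have "{T..T + 1} \<in> null_sets lebesgue"
    by (subst AE_iff_null_sets) auto
  then show False
    by (auto simp: null_sets_def)
qed

text \<open>The vector is q(A) A^m v, whose observations are combinations of those of
  \<open>v\<close>.\<close>

lemma unobservable_poly_shift:
  assumes A: "A \<in> carrier_mat n n" and C: "C \<in> carrier_mat p n" and v: "v \<in> unobservable A C"
  shows "vec n (\<lambda>i. poly_shift q (\<lambda>k. (A ^\<^sub>m k *\<^sub>v v) $ i) m) \<in> unobservable A C"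
proof -
  have v': "v \<in> carrier_vec n"
    using v A by (auto simp: unobservable_def)
  have "(C *\<^sub>v (A ^\<^sub>m j *\<^sub>v vec n (\<lambda>i. poly_shift q (\<lambda>k. (A ^\<^sub>m k *\<^sub>v v) $ i) m))) $ l = 0"
    if "l < p" for j l
    unfolding poly_shift_mult_mat_vec[OF A C v' that]
    by (rule poly_shift_zero_fun) (use v C that in \<open>auto simp: unobservable_def\<close>)
  then show ?thesis
    using A C by (auto simp: unobservable_def)
qed

lemma map_poly_of_real_mult:
  "map_poly complex_of_real (p * q) = map_poly complex_of_real p * map_poly complex_of_real q"
  by (intro poly_eqI) (simp add: coeff_map_poly coeff_mult)

lemma map_poly_of_real_power: "map_poly complex_of_real (p ^ k) = map_poly complex_of_real p ^ k"
  by (induction k) (simp_all add: map_poly_of_real_mult)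

text \<open>A real polynomial of least degree that annihilates all output sequences \<open>k \<mapsto> K A\<^sup>k v\<close> with
  unobservable \<open>v\<close> is stable: for a root \<open>l\<close>, the quotient by \<open>X - l\<close> does not annihilate all of them, and
  applied to one of them it yields a nonzero geometric sequence with ratio \<open>l\<close>.\<close>

lemma stable_annihilator:
  assumes A: "A \<in> carrier_mat n n" and C: "C \<in> carrier_mat p n" and K: "K \<in> carrier_mat r n"
    and decays: "\<And>v l. v \<in> unobservable A C \<Longrightarrow> l < r \<Longrightarrow> decays (\<lambda>k. (K *\<^sub>v (A ^\<^sub>m k *\<^sub>v v)) $ l)"
  obtains q :: "real poly" where "q \<noteq> 0"
    and "\<And>z. poly (map_poly complex_of_real q) z = 0 \<Longrightarrow> Re z < 0"
    and "\<And>v l j. v \<in> unobservable A C \<Longrightarrow> l < r \<Longrightarrow> poly_shift q (\<lambda>k. (K *\<^sub>v (A ^\<^sub>m k *\<^sub>v v)) $ l) j = 0"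
proof -
  define out where "out v l k = (K *\<^sub>v (A ^\<^sub>m k *\<^sub>v v)) $ l" for v and l k :: nat
  define ann where "ann q \<longleftrightarrow> q \<noteq> 0 \<and>
    (\<forall>v\<in>unobservable A C. \<forall>l<r. \<forall>j. poly_shift q (out v l) j = 0)" for q :: "real poly"
  have carrier: "v \<in> carrier_vec n" if "v \<in> unobservable A C" for v
    using that A by (auto simp: unobservable_def)
  obtain q0 where "q0 \<noteq> 0" "\<And>r M v l j. M \<in> carrier_mat r n \<Longrightarrow> v \<in> carrier_vec n \<Longrightarrow> l < r \<Longrightarrow>
      poly_shift q0 (\<lambda>k. (M *\<^sub>v (A ^\<^sub>m k *\<^sub>v v)) $ l) j = 0"
    using annihilating_poly_exists[OF A] by blast
  then have "ann q0"
    using K carrier by (auto simp: ann_def out_def[abs_def])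
  then obtain q where q: "ann q" and min: "\<And>q'. ann q' \<Longrightarrow> degree q \<le> degree q'"
    using ex_has_least_nat[of ann q0 degree] by blast
  have "Re z < 0" if z: "poly (map_poly complex_of_real q) z = 0" for z
  proof -
    let ?Q = "map_poly complex_of_real q"
    obtain s where s: "?Q = [:- z, 1:] * s"
      using z by (auto simp: poly_eq_0_iff_dvd elim: dvdE)
    have "?Q \<noteq> 0"
      using q by (auto simp: ann_def map_poly_eq_0_iff)
    then have "s \<noteq> 0"
      using s by auto
    have "degree ?Q = Suc (degree s)"
      using \<open>s \<noteq> 0\<close> unfolding s by (subst degree_mult_eq) auto
    then have deg: "degree q = Suc (degree s)"
      by (simp add: degree_map_poly)
    \<comment> \<open>\<open>s\<close> inherits the real nonzero leading coefficient of
      \<open>q\<close>, so its coefficientwise real part is nonzero; as its degree is smaller,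
      minimality of \<open>q\<close> applies.\<close>
    have "lead_coeff ?Q = lead_coeff s"
      unfolding s by (simp only: lead_coeff_mult) simp
    then have "complex_of_real (lead_coeff q) = lead_coeff s"
      by (simp add: coeff_map_poly degree_map_poly)
    then have "Re (lead_coeff s) \<noteq> 0"
      using q by (auto simp: ann_def complex_eq_iff)
    then have "map_poly Re s \<noteq> 0"
      by (metis coeff_0 coeff_map_poly zero_complex.sel(1))
    moreover have "degree (map_poly Re s) < degree q"
      unfolding deg by (intro le_imp_less_Suc degree_le) (simp add: coeff_map_poly coeff_eq_0)
    ultimately have "\<not> (\<forall>v\<in>unobservable A C. \<forall>l<r. \<forall>j. poly_shift (map_poly Re s) (out v l) j = 0)"
      using min[of "map_poly Re s"] by (auto simp: ann_def)
    then obtain v l j where v: "v \<in> unobservable A C" and l: "l < r"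
      and nz: "poly_shift (map_poly Re s) (out v l) j \<noteq> 0"
      by blast
    \<comment> \<open>The offset \<open>j\<close> moves the nonzero term of \<open>nz\<close> to
      index 0, where it is the real part of \<open>g\<close>.\<close>
    define g where "g k = poly_shift s (\<lambda>k. complex_of_real (out v l k)) (k + j)" for k
    show ?thesis
    proof (rule Re_neg_if_decays)
      show "g (Suc k) = z * g k" for k
      proof -
        have "0 = poly_shift ?Q (\<lambda>k. complex_of_real (out v l k)) (k + j)"
          using q v l by (simp add: ann_def poly_shift_of_real)
        also have "\<dots> = g (Suc k) - z * g k"
          unfolding s poly_shift_mult by (simp add: poly_shift_pCons g_def)
        finally show ?thesis by simp
      qed
      show "g 0 \<noteq> 0"
        using nz by (auto simp: g_def poly_shift_Re)
      \<comment> \<open>The shifted sequence is the output of s'(A) A^j v, which is again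
        unobservable.\<close>
      have "decays (\<lambda>k. poly_shift s' (out v l) (k + j))" for s'
        using decays[OF unobservable_poly_shift[OF A C v, of s' j] l]
          poly_shift_mult_mat_vec[OF A K carrier[OF v] l, of _ s' j]
        by (simp add: out_def[abs_def])
      from this[of "map_poly Re s"] this[of "map_poly Im s"]
      show "decays (\<lambda>k. Re (g k))" "decays (\<lambda>k. Im (g k))"
        by (simp_all add: g_def poly_shift_Re poly_shift_Im)
    qed
  qed
  then show ?thesis
    using q by (intro that[of q]) (auto simp: ann_def out_def[abs_def])
qed

text \<open>Multiplying by a power of \<open>X + 1\<close> makes the degree at least that of an annihilating polynomial of
  \<open>A\<close>, so that the observations \<open>C A\<^sup>j\<close> with \<open>j\<close> below the degree span all observations.\<close>

lemma output_injection_exists: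
  assumes A: "A \<in> carrier_mat n n" and C: "C \<in> carrier_mat p n" and K: "K \<in> carrier_mat r n"
    and decays: "\<And>v l. v \<in> unobservable A C \<Longrightarrow> l < r \<Longrightarrow> decays (\<lambda>k. (K *\<^sub>v (A ^\<^sub>m k *\<^sub>v v)) $ l)"
  obtains a :: "real poly" and Y :: "nat \<Rightarrow> nat \<Rightarrow> nat \<Rightarrow> real"
  where "lead_coeff a = 1" and "0 < degree a"
    and "\<And>z. poly (map_poly complex_of_real a) z = 0 \<Longrightarrow> Re z < 0"
    and "\<And>l v. l < r \<Longrightarrow> v \<in> carrier_vec n \<Longrightarrow>
      poly_shift a (\<lambda>k. (K *\<^sub>v (A ^\<^sub>m k *\<^sub>v v)) $ l) 0 =
      (\<Sum>j<degree a. \<Sum>i<p. Y l j i * (C *\<^sub>v (A ^\<^sub>m j *\<^sub>v v)) $ i)"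
proof -
  obtain q where q0: "q \<noteq> 0" and qz: "\<And>z. poly (map_poly complex_of_real q) z = 0 \<Longrightarrow> Re z < 0"
    and qa: "\<And>v l j. v \<in> unobservable A C \<Longrightarrow> l < r \<Longrightarrow> poly_shift q (\<lambda>k. (K *\<^sub>v (A ^\<^sub>m k *\<^sub>v v)) $ l) j = 0"
    using stable_annihilator[OF A C K decays] by metis
  obtain b where b0: "b \<noteq> 0" and b: "\<And>r M v l j. M \<in> carrier_mat r n \<Longrightarrow> v \<in> carrier_vec n \<Longrightarrow> l < r \<Longrightarrow>
      poly_shift b (\<lambda>k. (M *\<^sub>v (A ^\<^sub>m k *\<^sub>v v)) $ l) j = 0"
    using annihilating_poly_exists[OF A] by blast
  \<comment> \<open>The exponent makes \<open>degree a\<close> positive and larger than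
    \<open>degree b\<close>; the added factor has only the stable root -1, and the scalar makes
    \<open>a\<close> monic.\<close>
  define a where "a = Polynomial.smult (inverse (lead_coeff q)) ([:1, 1:] ^ Suc (degree b) * q)"
  have deg: "degree a = Suc (degree b) + degree q"
    using q0 by (simp add: a_def degree_mult_eq degree_power_eq del: power_Suc)
  have monic: "lead_coeff a = 1"
    using q0 by (simp add: a_def lead_coeff_mult lead_coeff_power del: power_Suc)
  have stable: "Re z < 0" if "poly (map_poly complex_of_real a) z = 0" for z
  proof -
    have "map_poly complex_of_real a =
        Polynomial.smult (inverse (lead_coeff q)) ([:1, 1:] ^ Suc (degree b) * map_poly complex_of_real q)"
      by (simp add: a_def map_poly_smult map_poly_of_real_mult map_poly_of_real_power map_poly_pCons del: power_Suc)
    then have "(1 + z) ^ Suc (degree b) = 0 \<or> poly (map_poly complex_of_real q) z = 0"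
      using that q0 by (simp del: power_Suc)
    then show ?thesis
      using qz[of z] by (auto simp: add_eq_0_iff)
  qed
  have ex: "\<exists>y. \<forall>v\<in>carrier_vec n. poly_shift a (\<lambda>k. (K *\<^sub>v (A ^\<^sub>m k *\<^sub>v v)) $ l) 0 =
      (\<Sum>ji\<in>{..<degree a} \<times> {..<p}. y ji * (C *\<^sub>v (A ^\<^sub>m fst ji *\<^sub>v v)) $ snd ji)" if l: "l < r" for l
  proof (rule functional_in_span)
    have lin: "(M *\<^sub>v (A ^\<^sub>m k *\<^sub>v (v + c \<cdot>\<^sub>v w))) $ i =
        (M *\<^sub>v (A ^\<^sub>m k *\<^sub>v v)) $ i + c * (M *\<^sub>v (A ^\<^sub>m k *\<^sub>v w)) $ i"
      if "M \<in> carrier_mat s n" "v \<in> carrier_vec n" "w \<in> carrier_vec n" "i < s" for M s v w c k i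
    proof -
      note carrier = that pow_mat_mult_vec_carrier[OF A, of _ k] pow_carrier_mat[OF A, of k]
      have "A ^\<^sub>m k *\<^sub>v (v + c \<cdot>\<^sub>v w) = A ^\<^sub>m k *\<^sub>v v + c \<cdot>\<^sub>v (A ^\<^sub>m k *\<^sub>v w)"
        using carrier by (simp add: mult_add_distrib_mat_vec[where nc = n] mult_mat_vec[where nc = n])
      moreover have "row M i \<in> carrier_vec n"
        using that by auto
      ultimately show ?thesis
        using carrier
        by (simp add: scalar_prod_add_distrib[where n = n] scalar_prod_smult_distrib[where n = n])
    qed
    show "finite ({..<degree a} \<times> {..<p})"
      by simp
    show "v + c \<cdot>\<^sub>v w \<in> carrier_vec n" if "v \<in> carrier_vec n" "w \<in> carrier_vec n" for v w and c :: real
      using that by simp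
    show "(C *\<^sub>v (A ^\<^sub>m fst ji *\<^sub>v (v + c \<cdot>\<^sub>v w))) $ snd ji =
        (C *\<^sub>v (A ^\<^sub>m fst ji *\<^sub>v v)) $ snd ji + c * (C *\<^sub>v (A ^\<^sub>m fst ji *\<^sub>v w)) $ snd ji"
      if "ji \<in> {..<degree a} \<times> {..<p}" "v \<in> carrier_vec n" "w \<in> carrier_vec n" for ji v w c
      using that by (intro lin[OF C]) auto
    show "poly_shift a (\<lambda>k. (K *\<^sub>v (A ^\<^sub>m k *\<^sub>v (v + c \<cdot>\<^sub>v w))) $ l) 0 =
        poly_shift a (\<lambda>k. (K *\<^sub>v (A ^\<^sub>m k *\<^sub>v v)) $ l) 0 + c * poly_shift a (\<lambda>k. (K *\<^sub>v (A ^\<^sub>m k *\<^sub>v w)) $ l) 0"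
      if "v \<in> carrier_vec n" "w \<in> carrier_vec n" for v w c
      by (simp add: lin[OF K that l] poly_shift_add_fun poly_shift_cmult_fun)
    show "poly_shift a (\<lambda>k. (K *\<^sub>v (A ^\<^sub>m k *\<^sub>v v)) $ l) 0 = 0"
      if v: "v \<in> carrier_vec n"
        and 0: "\<And>ji. ji \<in> {..<degree a} \<times> {..<p} \<Longrightarrow> (C *\<^sub>v (A ^\<^sub>m fst ji *\<^sub>v v)) $ snd ji = 0" for v
    proof -
      \<comment> \<open>Each observation sequence obeys the recurrence of \<open>b\<close>, and its
        first \<open>degree b\<close> terms are among those assumed to vanish.\<close>
      have "(C *\<^sub>v (A ^\<^sub>m j *\<^sub>v v)) $ i = 0" if "i < p" for i j
        by (rule poly_shift_eq_0_initial[OF b0 b[OF C v that]]) (use 0[of "(_, i)"] that deg in auto)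
      then have "v \<in> unobservable A C"
        using v A C by (auto simp: unobservable_def)
      then show ?thesis
        using qa l by (simp add: a_def poly_shift_smult poly_shift_mult_eq_0 del: power_Suc)
    qed
  qed
  have "\<forall>l\<in>{..<r}. \<exists>y. \<forall>v\<in>carrier_vec n. poly_shift a (\<lambda>k. (K *\<^sub>v (A ^\<^sub>m k *\<^sub>v v)) $ l) 0 =
      (\<Sum>ji\<in>{..<degree a} \<times> {..<p}. y ji * (C *\<^sub>v (A ^\<^sub>m fst ji *\<^sub>v v)) $ snd ji)"
    using ex by simp
  then obtain y where y: "\<forall>l\<in>{..<r}. \<forall>v\<in>carrier_vec n. poly_shift a (\<lambda>k. (K *\<^sub>v (A ^\<^sub>m k *\<^sub>v v)) $ l) 0 =
      (\<Sum>ji\<in>{..<degree a} \<times> {..<p}. y l ji * (C *\<^sub>v (A ^\<^sub>m fst ji *\<^sub>v v)) $ snd ji)"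
    by (rule bchoice[THEN exE])
  show ?thesis
  proof (rule that[OF monic _ stable, where Y = "\<lambda>l j i. y l (j, i)"])
    show "0 < degree a"
      by (simp add: deg)
    show "poly_shift a (\<lambda>k. (K *\<^sub>v (A ^\<^sub>m k *\<^sub>v v)) $ l) 0 =
        (\<Sum>j<degree a. \<Sum>i<p. y l (j, i) * (C *\<^sub>v (A ^\<^sub>m j *\<^sub>v v)) $ i)"
      if "l < r" "v \<in> carrier_vec n" for l v
      using y that by (simp add: sum.cartesian_product case_prod_unfold)
  qed
qed

subsection \<open>Solutions of the system\<close>

lemma L1_loc_iff:
  fixes f :: "real \<Rightarrow> real vec"
  shows "f \<in> L1_loc k \<longleftrightarrow> (\<forall>t. f t \<in> carrier_vec k) \<and> (\<forall>i<k. locally_integrable (\<lambda>t. f t $ i))"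
  by (simp add: L1_loc_def locally_integrable_def)

lemma weak_derivative_iff:
  fixes f g :: "real \<Rightarrow> real vec"
  shows "weak_derivative k f g \<longleftrightarrow> (\<forall>t. f t \<in> carrier_vec k) \<and> (\<forall>t. g t \<in> carrier_vec k) \<and>
    (\<forall>i<k. is_weak_derivative (\<lambda>t. f t $ i) (\<lambda>t. g t $ i))"
  by (auto simp: weak_derivative_def L1_loc_iff is_weak_derivative_def)

lemma eucl_norm_eq:
  fixes v :: "real vec"
  shows "v \<in> carrier_vec r \<Longrightarrow> eucl_norm v = sqrt (\<Sum>i<r. (v $ i)\<^sup>2)"
  by (auto simp: eucl_norm_def scalar_prod_def power2_eq_square atLeast0LessThan)

lemma abs_index_le_eucl_norm:
  fixes v :: "real vec"
  assumes "v \<in> carrier_vec r" and "i < r"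
  shows "\<bar>v $ i\<bar> \<le> eucl_norm v"
proof -
  have "(v $ i)\<^sup>2 \<le> (\<Sum>i<r. (v $ i)\<^sup>2)"
    using assms by (intro member_le_sum) auto
  then show ?thesis
    unfolding eucl_norm_eq[OF assms(1)] by (rule real_le_rsqrt[of "\<bar>v $ i\<bar>", simplified])
qed

lemma eucl_norm_le_sum:
  fixes v :: "real vec"
  assumes "v \<in> carrier_vec r"
  shows "eucl_norm v \<le> (\<Sum>i<r. \<bar>v $ i\<bar>)"
  unfolding eucl_norm_eq[OF assms] using L2_set_le_sum_abs[of "\<lambda>i. v $ i" "{..<r}"] by (simp add: L2_set_def)

lemma AE_restrict_atLeast_iff:
  "(AE s in restrict_space lebesgue {t::real..}. P s) \<longleftrightarrow> (AE s in lebesgue. t \<le> s \<longrightarrow> P s)"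
  by (subst AE_restrict_space_iff) auto

lemma ess_tends_to_0D:
  assumes f: "ess_tends_to_0 f" and "0 < \<epsilon>"
  obtains T where "AE t in lebesgue. T \<le> t \<longrightarrow> eucl_norm (f t) < \<epsilon>"
proof -
  have "\<forall>\<^sub>F t in at_top. esssup (restrict_space lebesgue {t..}) (\<lambda>s. ereal (eucl_norm (f s))) < ereal \<epsilon>"
    using f \<open>0 < \<epsilon>\<close> unfolding ess_tends_to_0_def by (intro order_tendstoD) auto
  then obtain T where T: "esssup (restrict_space lebesgue {T..}) (\<lambda>s. ereal (eucl_norm (f s))) < ereal \<epsilon>"
    by (auto simp: eventually_at_top_linorder)
  have "AE s in restrict_space lebesgue {T..}. eucl_norm (f s) < \<epsilon>"
    using esssup_AE[of "\<lambda>s. ereal (eucl_norm (f s))" "restrict_space lebesgue {T..}"]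
  proof eventually_elim
    case (elim s)
    then have "ereal (eucl_norm (f s)) < ereal \<epsilon>"
      using T by (rule order.strict_trans1)
    then show ?case
      by simp
  qed
  then show ?thesis
    by (intro that) (simp add: AE_restrict_atLeast_iff)
qed

lemma ess_tends_to_0I:
  fixes f :: "real \<Rightarrow> real vec"
  assumes f: "\<And>t. f t \<in> carrier_vec r" "\<And>i. i < r \<Longrightarrow> (\<lambda>t. f t $ i) \<in> borel_measurable lebesgue"
    and lim: "\<And>i. i < r \<Longrightarrow> \<exists>E. (AE t in lebesgue. 0 \<le> t \<longrightarrow> f t $ i = E t) \<and> (E \<longlongrightarrow> 0) at_top"
  shows "ess_tends_to_0 f"
proof -
  let ?M = "\<lambda>t. restrict_space lebesgue {t::real..}"
  have "(\<lambda>s. eucl_norm (f s)) \<in> borel_measurable lebesgue"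
    unfolding eucl_norm_eq[OF f(1)]
    by (intro measurable_compose[OF _ borel_measurable_continuous_onI[of sqrt]] borel_measurable_sum
        borel_measurable_power f(2) continuous_intros) auto
  then have meas: "(\<lambda>s. ereal (eucl_norm (f s))) \<in> borel_measurable (?M t)" for t
    by (intro measurable_restrict_space1) simp
  \<comment> \<open>On a space of measure 0 the essential supremum would be minus infinity; the
    lower bound rests on the positive measure of the half-line.\<close>
  have nonneg: "0 \<le> esssup (?M t) (\<lambda>s. ereal (eucl_norm (f s)))" for t
  proof -
    have "emeasure lebesgue {t..t + 1} \<le> emeasure lebesgue {t..}"
      by (intro emeasure_mono) auto
    then have "emeasure lebesgue {t..} \<noteq> 0"
      by auto
    then have "emeasure (?M t) (space (?M t)) \<noteq> 0"
      by (simp add: emeasure_restrict_space space_restrict_space)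
    then have "0 = esssup (?M t) (\<lambda>s. 0::ereal)"
      by (rule esssup_const[symmetric])
    also have "\<dots> \<le> esssup (?M t) (\<lambda>s. ereal (eucl_norm (f s)))"
      by (intro esssup_mono) (auto simp: eucl_norm_eq[OF f(1)] sum_nonneg)
    finally show ?thesis .
  qed
  obtain E where E: "\<And>i. i < r \<Longrightarrow> AE t in lebesgue. 0 \<le> t \<longrightarrow> f t $ i = E i t"
    "\<And>i. i < r \<Longrightarrow> (E i \<longlongrightarrow> 0) at_top"
    using lim by metis
  have "AE t in lebesgue. \<forall>i\<in>{..<r}. 0 \<le> t \<longrightarrow> f t $ i = E i t"
    using E(1) by (intro AE_finite_allI) auto
  then have fE: "AE t in lebesgue. 0 \<le> t \<longrightarrow> eucl_norm (f t) \<le> (\<Sum>i<r. \<bar>E i t\<bar>)"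
  proof eventually_elim
    case (elim t)
    then show ?case
      using eucl_norm_le_sum[OF f(1)[of t]] by (auto intro: order.trans)
  qed
  have "((\<lambda>t. \<Sum>i<r. \<bar>E i t\<bar>) \<longlongrightarrow> (\<Sum>i<r. \<bar>0\<bar>)) at_top"
    by (intro tendsto_intros E(2)) auto
  then have lim: "((\<lambda>t. \<Sum>i<r. \<bar>E i t\<bar>) \<longlongrightarrow> 0) at_top"
    by simp
  show ?thesis
    unfolding ess_tends_to_0_def
  proof (rule order_tendstoI)
    fix a :: ereal assume "a < 0"
    then show "\<forall>\<^sub>F t in at_top. a < esssup (?M t) (\<lambda>s. ereal (eucl_norm (f s)))"
      using nonneg by (intro always_eventually allI) (rule order.strict_trans2)
  next
    fix a :: ereal assume "0 < a"
    then obtain \<epsilon> where \<epsilon>: "0 < \<epsilon>" "ereal \<epsilon> < a"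
      by (metis ereal_dense2 ereal_less(2) zero_ereal_def)
    have "\<forall>\<^sub>F t in at_top. (\<Sum>i<r. \<bar>E i t\<bar>) < \<epsilon>"
      using lim \<epsilon>(1) by (rule order_tendstoD)
    then obtain T where T: "\<And>t. T \<le> t \<Longrightarrow> (\<Sum>i<r. \<bar>E i t\<bar>) < \<epsilon>"
      by (auto simp: eventually_at_top_linorder)
    show "\<forall>\<^sub>F t in at_top. esssup (?M t) (\<lambda>s. ereal (eucl_norm (f s))) < a"
      using eventually_ge_at_top[of "max 0 T"]
    proof eventually_elim
      case (elim t)
      have "AE s in lebesgue. t \<le> s \<longrightarrow> ereal (eucl_norm (f s)) \<le> ereal \<epsilon>"
        using fE
      proof eventually_elim
        case (elim s)
        then show ?case
          using T[of s] \<open>max 0 T \<le> t\<close> by auto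
      qed
      then have "esssup (?M t) (\<lambda>s. ereal (eucl_norm (f s))) \<le> ereal \<epsilon>"
        using meas by (intro esssup_I) (simp_all add: AE_restrict_atLeast_iff)
      then show ?case
        using \<epsilon>(2) by (rule order.strict_trans1)
    qed
  qed
qed

section \<open>The solution exp(tA) v and its outputs\<close>

lemma pow_mat_mult_vec_bound:
  fixes A :: "real mat"
  assumes A: "A \<in> carrier_mat n n" and v: "v \<in> carrier_vec n"
  obtains B R where "\<And>i k. i < n \<Longrightarrow> \<bar>(A ^\<^sub>m k *\<^sub>v v) $ i\<bar> \<le> B * R ^ k"
proof
  define B where "B = (\<Sum>s<n. \<bar>v $ s\<bar>)"
  \<comment> \<open>The sum of all absolute entries dominates every row sum, so each power of
    \<open>A\<close> costs one factor \<open>R\<close>.\<close>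
  define R where "R = (\<Sum>i<n. \<Sum>s<n. \<bar>A $$ (i, s)\<bar>)"
  show "\<bar>(A ^\<^sub>m k *\<^sub>v v) $ i\<bar> \<le> B * R ^ k" if "i < n" for i k
    using that
  proof (induction k arbitrary: i)
    case 0
    then show ?case
      using A v by (auto simp: B_def intro!: member_le_sum)
  next
    case (Suc k)
    have "\<bar>(A ^\<^sub>m Suc k *\<^sub>v v) $ i\<bar> = \<bar>\<Sum>s<n. A $$ (i, s) * (A ^\<^sub>m k *\<^sub>v v) $ s\<bar>"
      unfolding pow_mat_Suc_mult_vec[OF A v]
      by (subst mult_mat_vec_nth[OF A pow_mat_mult_vec_carrier[OF A v] Suc.prems]) simp
    also have "\<dots> \<le> (\<Sum>s<n. \<bar>A $$ (i, s)\<bar> * (B * R ^ k))"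
      using Suc.IH by (intro order.trans[OF sum_abs] sum_mono) (auto simp: abs_mult intro!: mult_left_mono)
    also have "\<dots> = (\<Sum>s<n. \<bar>A $$ (i, s)\<bar>) * (B * R ^ k)"
      by (simp add: sum_distrib_right)
    also have "\<dots> \<le> R * (B * R ^ k)"
      unfolding R_def using Suc.prems
      by (intro mult_right_mono member_le_sum[of i "{..<n}" "\<lambda>i. \<Sum>s<n. \<bar>A $$ (i, s)\<bar>"])
        (auto simp: B_def intro!: sum_nonneg mult_nonneg_nonneg zero_le_power)
    finally show ?case
      by (simp add: mult_ac)
  qed
qed

lemma continuous_imp_L1_loc:
  fixes f :: "real \<Rightarrow> real vec"
  assumes "\<And>t. f t \<in> carrier_vec k" and "\<And>i. i < k \<Longrightarrow> continuous_on UNIV (\<lambda>t. f t $ i)"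
  shows "f \<in> L1_loc k"
  using assms by (simp add: L1_loc_iff locally_integrable_continuous)

text \<open>This is exp(tA) v as an entrywise power series; stating the series for every
  \<open>M\<close> covers both C x and K x.\<close>

lemma exp_solution:
  fixes A :: "real mat"
  assumes A: "A \<in> carrier_mat n n" and v: "v \<in> carrier_vec n"
  obtains x x' :: "real \<Rightarrow> real vec" where "weak_derivative n x x'" and "\<And>t. x' t = A *\<^sub>v x t" and "\<And>t. x t \<in> carrier_vec n"
    and "\<And>i. i < n \<Longrightarrow> continuous_on UNIV (\<lambda>t. x t $ i)"
    and "\<And>M s i t. M \<in> carrier_mat s n \<Longrightarrow> i < s \<Longrightarrow>
      (M *\<^sub>v x t) $ i = (\<Sum>k. (M *\<^sub>v (A ^\<^sub>m k *\<^sub>v v)) $ i / fact k * t ^ k)"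
proof -
  obtain B R where bnd: "\<And>i k. i < n \<Longrightarrow> \<bar>(A ^\<^sub>m k *\<^sub>v v) $ i\<bar> \<le> B * R ^ k"
    using pow_mat_mult_vec_bound[OF A v] by blast
  \<comment> \<open>\<open>y j\<close> is exp(tA) A^j v, the j-th derivative of the solution;
    continuity of \<open>y 1\<close> comes from its derivative \<open>y 2\<close>.\<close>
  define y where "y j t = vec n (\<lambda>i. \<Sum>k. (A ^\<^sub>m (k + j) *\<^sub>v v) $ i / fact k * t ^ k)" for j t
  have bnd': "\<bar>(A ^\<^sub>m (k + j) *\<^sub>v v) $ i\<bar> \<le> (B * R ^ j) * R ^ k" if "i < n" for i j k
    using bnd[OF that, of "k + j"] by (simp add: power_add mult_ac)
  have D: "((\<lambda>t. y j t $ i) has_real_derivative y (Suc j) t $ i) (at t)" if "i < n" for i j t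
    using exp_series_DERIV[of "\<lambda>k. (A ^\<^sub>m (k + j) *\<^sub>v v) $ i", OF bnd'[OF that]] that
    by (simp add: y_def)
  have c: "continuous_on UNIV (\<lambda>t. y j t $ i)" if "i < n" for i j
    by (rule DERIV_continuous_on, rule has_field_derivative_at_within, rule D[OF that])
  have car: "y j t \<in> carrier_vec n" for j t
    by (simp add: y_def)
  have out: "(M *\<^sub>v y j t) $ i = (\<Sum>k. (M *\<^sub>v (A ^\<^sub>m (k + j) *\<^sub>v v)) $ i / fact k * t ^ k)"
    if M: "M \<in> carrier_mat s n" "i < s" for M s i j t
  proof -
    have s: "summable (\<lambda>k. (A ^\<^sub>m (k + j) *\<^sub>v v) $ i / fact k * t ^ k)" if "i < n" for i
      by (rule exp_series_summable[OF bnd'[OF that]])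
    have "(M *\<^sub>v y j t) $ i = (\<Sum>s<n. \<Sum>k. M $$ (i, s) * ((A ^\<^sub>m (k + j) *\<^sub>v v) $ s / fact k * t ^ k))"
      unfolding mult_mat_vec_nth[OF M(1) car M(2)]
      by (intro sum.cong refl) (simp add: y_def suminf_mult[OF s, symmetric] del: times_divide_eq_left)
    also have "\<dots> = (\<Sum>k. \<Sum>s<n. M $$ (i, s) * ((A ^\<^sub>m (k + j) *\<^sub>v v) $ s / fact k * t ^ k))"
      using s by (intro suminf_sum[symmetric] summable_mult) auto
    also have "\<dots> = (\<Sum>k. (M *\<^sub>v (A ^\<^sub>m (k + j) *\<^sub>v v)) $ i / fact k * t ^ k)"
      by (simp add: mult_mat_vec_nth[OF M(1) pow_mat_mult_vec_carrier[OF A v] M(2)] sum_divide_distrib sum_distrib_right mult.assoc)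
    finally show ?thesis .
  qed
  show ?thesis
  proof (rule that[of "y 0" "y 1"])
    show "weak_derivative n (y 0) (y 1)"
      using D[of _ 0] c[of _ 1] car by (auto simp: weak_derivative_iff intro!: is_weak_derivative_continuous)
    show "y 1 t = A *\<^sub>v y 0 t" for t
    proof (rule eq_vecI)
      show "y 1 t $ i = (A *\<^sub>v y 0 t) $ i" if "i < dim_vec (A *\<^sub>v y 0 t)" for i
        using that A out[OF A, of i 0 t] by (simp add: y_def pow_mat_Suc_mult_vec[OF A v] del: index_mult_mat_vec pow_mat.simps)
    qed (use A in \<open>simp add: y_def\<close>)
  qed (use c car out[of _ _ _ 0] in auto)
qed

lemma mult_mat_zero_vec:
  fixes M :: "'a::comm_semiring_1 mat"
  assumes "M \<in> carrier_mat r n"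
  shows "M *\<^sub>v 0\<^sub>v n = 0\<^sub>v r"
  using assms by (intro eq_vecI) auto

lemma decays_if_partially_detectable:
  assumes A: "A \<in> carrier_mat n n" and B: "B \<in> carrier_mat n m" and C: "C \<in> carrier_mat p n"
    and D: "D \<in> carrier_mat p m" and K: "K \<in> carrier_mat r n"
    and det: "partially_detectable A B C D K"
    and v: "v \<in> unobservable A C" and l: "l < r"
  shows "decays (\<lambda>k. (K *\<^sub>v (A ^\<^sub>m k *\<^sub>v v)) $ l)"
proof -
  have v': "v \<in> carrier_vec n"
    using v A by (auto simp: unobservable_def)
  obtain x x' :: "real \<Rightarrow> real vec" where x: "weak_derivative n x x'" "\<And>t. x' t = A *\<^sub>v x t" "\<And>t. x t \<in> carrier_vec n"
      "\<And>i. i < n \<Longrightarrow> continuous_on UNIV (\<lambda>t. x t $ i)"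
    and out: "\<And>M s i t. M \<in> carrier_mat s n \<Longrightarrow> i < s \<Longrightarrow>
      (M *\<^sub>v x t) $ i = (\<Sum>k. (M *\<^sub>v (A ^\<^sub>m k *\<^sub>v v)) $ i / fact k * t ^ k)"
    using exp_solution[OF A v'] by blast
  have Cx: "C *\<^sub>v x t = 0\<^sub>v p" for t
  proof (rule eq_vecI)
    show "(C *\<^sub>v x t) $ i = 0\<^sub>v p $ i" if "i < dim_vec (0\<^sub>v p)" for i
    proof -
      have "(C *\<^sub>v (A ^\<^sub>m k *\<^sub>v v)) $ i = 0" for k
        using v that C by (auto simp: unobservable_def)
      then show ?thesis
        using out[OF C, of i t] that by (simp del: index_mult_mat_vec)
    qed
  qed (use C in simp)
  have zero: "(\<lambda>_. 0\<^sub>v k) \<in> L1_loc k" for k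
    by (rule continuous_imp_L1_loc) auto
  have zero': "weak_derivative k (\<lambda>_. 0\<^sub>v k) (\<lambda>_. 0\<^sub>v k)" for k
    by (auto simp: weak_derivative_iff intro!: is_weak_derivative_continuous)
  have Kx: "(\<lambda>t. K *\<^sub>v x t) \<in> L1_loc r"
  proof (rule continuous_imp_L1_loc)
    show "continuous_on UNIV (\<lambda>t. (K *\<^sub>v x t) $ i)" if "i < r" for i
      unfolding mult_mat_vec_nth[OF K x(3) that] by (intro continuous_intros x(4)) simp
  qed (use K x(3) in auto)
  have "system_solution A B C D K x (\<lambda>_. 0\<^sub>v m) (\<lambda>_. 0\<^sub>v p) (\<lambda>t. K *\<^sub>v x t)"
    unfolding system_solution_def
  proof (intro conjI exI[of _ x'])
    show "x \<in> L1_loc (dim_row A)" "weak_derivative (dim_row A) x x'"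
      using x(1) A by (auto simp: weak_derivative_def)
    show "AE t in lebesgue. x' t = A *\<^sub>v x t + B *\<^sub>v 0\<^sub>v m"
      using x(2) mult_mat_vec_carrier[OF A x(3)] by (intro AE_I2) (simp add: mult_mat_zero_vec[OF B])
    show "AE t in lebesgue. 0\<^sub>v p = C *\<^sub>v x t + D *\<^sub>v 0\<^sub>v m"
      using Cx by (intro AE_I2) (simp add: mult_mat_zero_vec[OF D])
  qed (use zero Kx B C K in auto)
  \<comment> \<open>Detectability compares two solutions; the second is the zero solution, with the
    same input and output.\<close>
  moreover have "system_solution A B C D K (\<lambda>_. 0\<^sub>v n) (\<lambda>_. 0\<^sub>v m) (\<lambda>_. 0\<^sub>v p) (\<lambda>_. 0\<^sub>v r)"
    unfolding system_solution_def
    using zero zero' A B C D K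
    by (auto simp: mult_mat_zero_vec intro!: exI[of _ "\<lambda>_. 0\<^sub>v n"])
  ultimately have "ess_tends_to_0 (\<lambda>t. K *\<^sub>v x t - 0\<^sub>v r)"
    using det unfolding partially_detectable_def by blast
  moreover have "K *\<^sub>v x t - 0\<^sub>v r = K *\<^sub>v x t" for t
    using K by (intro eq_vecI) auto
  ultimately have ess: "ess_tends_to_0 (\<lambda>t. K *\<^sub>v x t)"
    by simp
  show ?thesis
    unfolding decays_def
  proof (intro allI impI)
    fix \<epsilon> :: real assume "0 < \<epsilon>"
    then obtain T where T: "AE t in lebesgue. T \<le> t \<longrightarrow> eucl_norm (K *\<^sub>v x t) < \<epsilon>"
      using ess_tends_to_0D[OF ess] by blast
    have "AE t in lebesgue. T \<le> t \<longrightarrow> \<bar>\<Sum>k. (K *\<^sub>v (A ^\<^sub>m k *\<^sub>v v)) $ l / fact k * t ^ k\<bar> < \<epsilon>"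
      using T
    proof eventually_elim
      case (elim t)
      have "\<bar>(K *\<^sub>v x t) $ l\<bar> \<le> eucl_norm (K *\<^sub>v x t)"
        using K x(3) l by (intro abs_index_le_eucl_norm[where r = r]) auto
      then show ?case
        using elim unfolding out[OF K l] by auto
    qed
    then show "\<exists>T. AE t in lebesgue. T \<le> t \<longrightarrow> \<bar>\<Sum>k. (K *\<^sub>v (A ^\<^sub>m k *\<^sub>v v)) $ l / fact k * t ^ k\<bar> < \<epsilon>"
      by blast
  qed
qed

text \<open>Row \<open>l\<close> of block \<open>k\<close> of the matrix \<open>T\<close> for which the estimator state tracks \<open>T x\<close>; the \<open>Y l j\<close> are
  the rows of the gain in the identity \<open>K a(A) = \<Sum>\<^sub>j Y\<^sub>j C A\<^sup>j\<close>, which makes block number \<open>degree a\<close> vanish.\<close>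

primrec observer_row ::
  "nat \<Rightarrow> nat \<Rightarrow> real mat \<Rightarrow> real mat \<Rightarrow> real mat \<Rightarrow> real poly \<Rightarrow> (nat \<Rightarrow> nat \<Rightarrow> nat \<Rightarrow> real) \<Rightarrow> nat \<Rightarrow> nat \<Rightarrow> nat \<Rightarrow> real"
where
  "observer_row n p A C K a Y l 0 = (\<lambda>s. K $$ (l, s))"
| "observer_row n p A C K a Y l (Suc k) = (\<lambda>s. (\<Sum>s'<n. observer_row n p A C K a Y l k s' * A $$ (s', s)) +
     coeff a (degree a - Suc k) * K $$ (l, s) - (\<Sum>i<p. Y l (degree a - Suc k) i * C $$ (i, s)))"

lemma observer_row_Suc:
  fixes v :: "real vec"
  assumes A: "A \<in> carrier_mat n n" and C: "C \<in> carrier_mat p n" and K: "K \<in> carrier_mat r n"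
    and l: "l < r" and v: "v \<in> carrier_vec n"
  shows "(\<Sum>s<n. observer_row n p A C K a Y l (Suc k) s * v $ s) =
    (\<Sum>s<n. observer_row n p A C K a Y l k s * (A *\<^sub>v v) $ s) + coeff a (degree a - Suc k) * (K *\<^sub>v v) $ l
    - (\<Sum>i<p. Y l (degree a - Suc k) i * (C *\<^sub>v v) $ i)"
proof -
  let ?T = "observer_row n p A C K a Y l k"
  have "(\<Sum>s<n. (\<Sum>s'<n. ?T s' * A $$ (s', s)) * v $ s) = (\<Sum>s'<n. ?T s' * (\<Sum>s<n. A $$ (s', s) * v $ s))"
    unfolding sum_distrib_left sum_distrib_right by (subst sum.swap) (simp add: mult.assoc)
  also have "\<dots> = (\<Sum>s<n. ?T s * (A *\<^sub>v v) $ s)"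
    by (intro sum.cong) (auto simp: mult_mat_vec_nth[OF A v])
  finally have 1: "(\<Sum>s<n. (\<Sum>s'<n. ?T s' * A $$ (s', s)) * v $ s) = (\<Sum>s<n. ?T s * (A *\<^sub>v v) $ s)" .
  have "(\<Sum>s<n. (\<Sum>i<p. Y l (degree a - Suc k) i * C $$ (i, s)) * v $ s) =
      (\<Sum>i<p. Y l (degree a - Suc k) i * (\<Sum>s<n. C $$ (i, s) * v $ s))"
    unfolding sum_distrib_left sum_distrib_right by (subst sum.swap) (simp add: mult.assoc)
  also have "\<dots> = (\<Sum>i<p. Y l (degree a - Suc k) i * (C *\<^sub>v v) $ i)"
    by (intro sum.cong) (auto simp: mult_mat_vec_nth[OF C v])
  finally have 2: "(\<Sum>s<n. (\<Sum>i<p. Y l (degree a - Suc k) i * C $$ (i, s)) * v $ s) =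
      (\<Sum>i<p. Y l (degree a - Suc k) i * (C *\<^sub>v v) $ i)" .
  have "(\<Sum>s<n. coeff a (degree a - Suc k) * K $$ (l, s) * v $ s) = coeff a (degree a - Suc k) * (K *\<^sub>v v) $ l"
    by (simp add: mult_mat_vec_nth[OF K v l] sum_distrib_left mult.assoc)
  with 1 2 show ?thesis
    by (simp add: distrib_right left_diff_distrib sum.distrib sum_subtractf)
qed

text \<open>Unrolled, T_k is K A^k plus the sum over j < k of (a_{d-1-j} K - Y_{d-1-j} C) A^{k-1-j}.
  At k = d coefficient index and exponent agree, and \<open>Y\<close> was chosen to make the total
  vanish.\<close>

lemma observer_row_degree:
  fixes v :: "real vec"
  assumes A: "A \<in> carrier_mat n n" and C: "C \<in> carrier_mat p n" and K: "K \<in> carrier_mat r n"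
    and a: "lead_coeff a = 1"
    and Y: "\<And>l v. l < r \<Longrightarrow> v \<in> carrier_vec n \<Longrightarrow>
      poly_shift a (\<lambda>k. (K *\<^sub>v (A ^\<^sub>m k *\<^sub>v v)) $ l) 0 =
      (\<Sum>j<degree a. \<Sum>i<p. Y l j i * (C *\<^sub>v (A ^\<^sub>m j *\<^sub>v v)) $ i)"
    and l: "l < r" and v: "v \<in> carrier_vec n"
  shows "(\<Sum>s<n. observer_row n p A C K a Y l (degree a) s * v $ s) = 0"
proof -
  \<comment> \<open>\<open>g j i v\<close> is entry \<open>l\<close> of (a_j K - Y_j C) A^i
    v.\<close>
  define g where "g j i v = coeff a j * (K *\<^sub>v (A ^\<^sub>m i *\<^sub>v v)) $ l - (\<Sum>i'<p. Y l j i' * (C *\<^sub>v (A ^\<^sub>m i *\<^sub>v v)) $ i')"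
    for j i :: nat and v :: "real vec"
  have shift: "A ^\<^sub>m i *\<^sub>v (A *\<^sub>v v) = A ^\<^sub>m Suc i *\<^sub>v v" if "v \<in> carrier_vec n" for i and v :: "real vec"
    using pow_mat_add_mult_vec[OF A that, of i 1] A by simp
  have "(\<Sum>s<n. observer_row n p A C K a Y l k s * v $ s) =
      (K *\<^sub>v (A ^\<^sub>m k *\<^sub>v v)) $ l + (\<Sum>j<k. g (degree a - Suc j) (k - Suc j) v)"
    if "v \<in> carrier_vec n" for k and v :: "real vec"
    using that
  proof (induction k arbitrary: v)
    case 0
    then show ?case
      using A by (simp add: mult_mat_vec_nth[OF K _ l] del: index_mult_mat_vec)
  next
    case (Suc k)
    have Av: "A *\<^sub>v v \<in> carrier_vec n"
      using A Suc.prems by simp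
    have "(\<Sum>s<n. observer_row n p A C K a Y l (Suc k) s * v $ s) =
        (K *\<^sub>v (A ^\<^sub>m Suc k *\<^sub>v v)) $ l + (\<Sum>j<k. g (degree a - Suc j) (k - Suc j) (A *\<^sub>v v)) + g (degree a - Suc k) 0 v"
      unfolding observer_row_Suc[OF A C K l Suc.prems] Suc.IH[OF Av] shift[OF Suc.prems]
      using A Suc.prems by (simp add: g_def)
    also have "(\<Sum>j<k. g (degree a - Suc j) (k - Suc j) (A *\<^sub>v v)) = (\<Sum>j<k. g (degree a - Suc j) (Suc k - Suc j) v)"
      by (intro sum.cong) (auto simp: g_def shift[OF Suc.prems] Suc_diff_Suc simp del: pow_mat.simps index_mult_mat_vec)
    finally show ?case
      by simp
  qed
  note this[OF v, of "degree a"]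
  also have "(\<Sum>j<degree a. g (degree a - Suc j) (degree a - Suc j) v) = (\<Sum>j<degree a. g j j v)"
    by (rule sum.nat_diff_reindex)
  also have "(K *\<^sub>v (A ^\<^sub>m degree a *\<^sub>v v)) $ l + (\<Sum>j<degree a. g j j v) = 0"
  proof -
    have "poly_shift a (\<lambda>k. (K *\<^sub>v (A ^\<^sub>m k *\<^sub>v v)) $ l) 0 =
        (\<Sum>j<degree a. coeff a j * (K *\<^sub>v (A ^\<^sub>m j *\<^sub>v v)) $ l) + (K *\<^sub>v (A ^\<^sub>m degree a *\<^sub>v v)) $ l"
      using a by (simp add: poly_shift_def lessThan_Suc_atMost[symmetric] del: index_mult_mat_vec)
    then show ?thesis
      using Y[OF l v] by (simp add: g_def sum_subtractf del: index_mult_mat_vec)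
  qed
  finally show ?thesis .
qed

section \<open>The estimator matrices and the error equation\<close>

lemma div_mod_eq_iff:
  assumes "l < (r::nat)"
  shows "J mod r = l \<and> J div r = k \<longleftrightarrow> J = k * r + l"
proof
  assume "J mod r = l \<and> J div r = k"
  then show "J = k * r + l"
    using div_mult_mod_eq[of J r] by simp
qed (use assms in simp)

theorem theorem13:
  fixes A B C D K :: "real mat" and n m p r :: nat
  assumes "A \<in> carrier_mat n n" and "B \<in> carrier_mat n m"
    and "C \<in> carrier_mat p n" and "D \<in> carrier_mat p m" and "K \<in> carrier_mat r n"
    and "partially_detectable A B C D K"
  shows "\<exists>(q::nat) N H L R.
    N \<in> carrier_mat q q \<and> H \<in> carrier_mat q m \<and> L \<in> carrier_mat q p \<and> R \<in> carrier_mat r q \<and>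
    partial_state_estimator A B C D K N H L R"
proof -
  note A = assms(1) and B = assms(2) and C = assms(3) and D = assms(4) and K = assms(5)
  obtain a :: "real poly" and Y :: "nat \<Rightarrow> nat \<Rightarrow> nat \<Rightarrow> real"
    where monic: "lead_coeff a = 1" and deg: "0 < degree a"
    and stable: "\<And>z. poly (map_poly complex_of_real a) z = 0 \<Longrightarrow> Re z < 0"
    and Y: "\<And>l v. l < r \<Longrightarrow> v \<in> carrier_vec n \<Longrightarrow>
      poly_shift a (\<lambda>k. (K *\<^sub>v (A ^\<^sub>m k *\<^sub>v v)) $ l) 0 =
      (\<Sum>j<degree a. \<Sum>i<p. Y l j i * (C *\<^sub>v (A ^\<^sub>m j *\<^sub>v v)) $ i)"
    by (rule output_injection_exists[OF A C K decays_if_partially_detectable[OF assms]]) blast+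
  define d where "d = degree a"
  define b where "b k = coeff a (d - Suc k)" for k
  define T where "T l k = observer_row n p A C K a Y l k" for l k
  define G where "G l k i = Y l (d - Suc k) i" for l k i
  \<comment> \<open>Index \<open>k * r + l\<close> holds component \<open>l\<close> of block w_k, so
    \<open>div r\<close> gives the block and \<open>mod r\<close> the component; for
    \<open>r = 0\<close> the state is empty.\<close>
  define q where "q = d * r"
  define N where "N = mat q q (\<lambda>(I, J). if J mod r = I mod r
      then (if J div r = Suc (I div r) then 1 else 0) - (if J div r = 0 then b (I div r) else 0) else 0)"
  \<comment> \<open>The blocks T_k B - Y_{d-1-k} D remove \<open>u\<close> from the error: B enters
    through the derivative of T_k x, D through \<open>y\<close>.\<close>
  define H where "H = mat q m (\<lambda>(I, s). (\<Sum>s'<n. T (I mod r) (I div r) s' * B $$ (s', s))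
      - (\<Sum>i<p. G (I mod r) (I div r) i * D $$ (i, s)))"
  define L where "L = mat q p (\<lambda>(I, i). G (I mod r) (I div r) i)"
  define R where "R = mat r q (\<lambda>(l, J). if J = l then 1 else 0 :: real)"
  have N: "N \<in> carrier_mat q q" and H: "H \<in> carrier_mat q m" and L: "L \<in> carrier_mat q p" and R: "R \<in> carrier_mat r q"
    by (simp_all add: N_def H_def L_def R_def)
  have less_q: "k * r + l < q" if "k < d" "l < r" for k l
    unfolding q_def using that by (rule mult_add_less)
  have Nw: "(N *\<^sub>v w) $ (k * r + l) = (if Suc k < d then w $ (Suc k * r + l) else 0) - b k * w $ l"
    if w: "w \<in> carrier_vec q" and k: "k < d" and l: "l < r" for w k l
  proof -
    have "(N *\<^sub>v w) $ (k * r + l) = (\<Sum>J<q. N $$ (k * r + l, J) * w $ J)"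
      by (rule mult_mat_vec_nth[OF N w less_q[OF k l]])
    also have "\<dots> = (\<Sum>J<q. (if J = Suc k * r + l then w $ J else 0) - (if J = 0 * r + l then b k * w $ J else 0))"
    proof (intro sum.cong refl)
      fix J assume "J \<in> {..<q}"
      then show "N $$ (k * r + l, J) * w $ J =
          (if J = Suc k * r + l then w $ J else 0) - (if J = 0 * r + l then b k * w $ J else 0)"
        unfolding div_mod_eq_iff[OF l, symmetric] using less_q[OF k l] l by (auto simp: N_def left_diff_distrib)
    qed
    also have "\<dots> = (if Suc k * r + l < q then w $ (Suc k * r + l) else 0) - b k * w $ l"
      using less_q[OF deg[folded d_def] l] by (simp add: sum_subtractf)
    \<comment> \<open>The last block has no successor: there the shifted index is at least
      \<open>q\<close>.\<close>
    also have "Suc k * r + l < q \<longleftrightarrow> Suc k < d"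
    proof
      assume *: "Suc k * r + l < q"
      show "Suc k < d"
      proof (rule ccontr)
        assume "\<not> Suc k < d"
        then have "q \<le> Suc k * r"
          unfolding q_def by (intro mult_le_mono1) simp
        with * show False by simp
      qed
    qed (rule less_q[OF _ l])
    finally show ?thesis .
  qed
  have Hu: "(H *\<^sub>v u) $ (k * r + l) = (\<Sum>s<n. T l k s * (B *\<^sub>v u) $ s) - (\<Sum>i<p. G l k i * (D *\<^sub>v u) $ i)"
    if u: "u \<in> carrier_vec m" and k: "k < d" and l: "l < r" for u k l
  proof -
    have "(H *\<^sub>v u) $ (k * r + l) = (\<Sum>j<m. H $$ (k * r + l, j) * u $ j)"
      by (rule mult_mat_vec_nth[OF H u less_q[OF k l]])
    also have "\<dots> = (\<Sum>j<m. (\<Sum>s<n. T l k s * B $$ (s, j)) * u $ j) - (\<Sum>j<m. (\<Sum>i<p. G l k i * D $$ (i, j)) * u $ j)"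
      using l less_q[OF k l] by (simp add: H_def left_diff_distrib sum_subtractf)
    also have "(\<Sum>j<m. (\<Sum>s<n. T l k s * B $$ (s, j)) * u $ j) = (\<Sum>s<n. T l k s * (B *\<^sub>v u) $ s)"
    proof -
      have "(\<Sum>j<m. (\<Sum>s<n. T l k s * B $$ (s, j)) * u $ j) = (\<Sum>s<n. T l k s * (\<Sum>j<m. B $$ (s, j) * u $ j))"
        unfolding sum_distrib_left sum_distrib_right by (subst sum.swap) (simp add: mult.assoc)
      then show ?thesis
        by (simp add: mult_mat_vec_nth[OF B u] del: index_mult_mat_vec)
    qed
    also have "(\<Sum>j<m. (\<Sum>i<p. G l k i * D $$ (i, j)) * u $ j) = (\<Sum>i<p. G l k i * (D *\<^sub>v u) $ i)"
    proof -
      have "(\<Sum>j<m. (\<Sum>i<p. G l k i * D $$ (i, j)) * u $ j) = (\<Sum>i<p. G l k i * (\<Sum>j<m. D $$ (i, j) * u $ j))"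
        unfolding sum_distrib_left sum_distrib_right by (subst sum.swap) (simp add: mult.assoc)
      then show ?thesis
        by (simp add: mult_mat_vec_nth[OF D u] del: index_mult_mat_vec)
    qed
    finally show ?thesis .
  qed
  have Ly: "(L *\<^sub>v y) $ (k * r + l) = (\<Sum>i<p. G l k i * y $ i)"
    if y: "y \<in> carrier_vec p" and k: "k < d" and l: "l < r" for y k l
    unfolding mult_mat_vec_nth[OF L y less_q[OF k l]]
    using l less_q[OF k l] by (intro sum.cong) (simp_all add: L_def)
  have Rw: "(R *\<^sub>v w) $ l = w $ l" if w: "w \<in> carrier_vec q" and l: "l < r" for w l
    unfolding mult_mat_vec_nth[OF R w l]
    using l less_q[OF deg[folded d_def] l] by (simp add: R_def if_distrib[of "\<lambda>x. x * _"] cong: if_cong)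
  have "partial_state_estimator A B C D K N H L R"
    unfolding partial_state_estimator_def
  proof (intro allI impI)
    fix x u y z w zh
    assume sys: "system_solution A B C D K x u y z" and est: "estimator_solution N H L R w u y zh"
    obtain x' where x': "weak_derivative n x x'" "AE t in lebesgue. x' t = A *\<^sub>v x t + B *\<^sub>v u t"
      using sys A unfolding system_solution_def by auto
    obtain w' where w': "weak_derivative q w w'" "AE t in lebesgue. w' t = N *\<^sub>v w t + H *\<^sub>v u t + L *\<^sub>v y t"
      using est N unfolding estimator_solution_def by auto
    have y: "AE t in lebesgue. y t = C *\<^sub>v x t + D *\<^sub>v u t"
      and z: "AE t in lebesgue. z t = K *\<^sub>v x t" and zh: "AE t in lebesgue. zh t = R *\<^sub>v w t"
      using sys est unfolding system_solution_def estimator_solution_def by auto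
    have carrier: "x t \<in> carrier_vec n" "u t \<in> carrier_vec m" "y t \<in> carrier_vec p" "w t \<in> carrier_vec q"
      "z t \<in> carrier_vec r" "zh t \<in> carrier_vec r" for t
      using sys est A B C K N R unfolding system_solution_def estimator_solution_def L1_loc_iff by auto
    have zl: "locally_integrable (\<lambda>t. z t $ l)" "locally_integrable (\<lambda>t. zh t $ l)" if "l < r" for l
      using sys est K R that unfolding system_solution_def estimator_solution_def L1_loc_iff by auto
    show "ess_tends_to_0 (\<lambda>t. zh t - z t)"
    proof (rule ess_tends_to_0I)
      show "zh t - z t \<in> carrier_vec r" for t
        using carrier by simp
      show "(\<lambda>t. (zh t - z t) $ l) \<in> borel_measurable lebesgue" if l: "l < r" for l
      proof -
        have "(zh t - z t) $ l = zh t $ l - z t $ l" for t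
          using carrier(5)[of t] l by simp
        then show ?thesis
          using zl[OF l, THEN locally_integrable_measurable] by simp
      qed
      show "\<exists>E. (AE t in lebesgue. 0 \<le> t \<longrightarrow> (zh t - z t) $ l = E t) \<and> (E \<longlongrightarrow> 0) at_top" if l: "l < r" for l
      proof -
        \<comment> \<open>The absent block w_d counts as 0, so \<open>e d\<close> is -T_d x, which
          vanishes by \<open>observer_row_degree\<close>.\<close>
        define e where "e k t = (if k < d then w t $ (k * r + l) else 0) - (\<Sum>s<n. T l k s * x t $ s)" for k t
        define e' where "e' k t = w' t $ (k * r + l) - (\<Sum>s<n. T l k s * x' t $ s)" for k t
        have xd: "is_weak_derivative (\<lambda>t. x t $ s) (\<lambda>t. x' t $ s)" if "s < n" for s
          using x'(1) that by (simp add: weak_derivative_iff)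
        have wd: "is_weak_derivative (\<lambda>t. w t $ (k * r + l)) (\<lambda>t. w' t $ (k * r + l))" if "k < d" for k
          using w'(1) less_q[OF that l] by (simp add: weak_derivative_iff)
        have ed: "is_weak_derivative (e k) (e' k)" if "k < d" for k
        proof -
          have "is_weak_derivative (\<lambda>t. w t $ (k * r + l) + (- 1) * (\<Sum>s<n. T l k s * x t $ s))
              (\<lambda>t. w' t $ (k * r + l) + (- 1) * (\<Sum>s<n. T l k s * x' t $ s))"
            by (intro is_weak_derivative_add is_weak_derivative_cmult is_weak_derivative_sum wd[OF that] xd) simp
          then show ?thesis
            using that by (simp add: e_def[abs_def] e'_def[abs_def])
        qed
        have e_d: "e d t = 0" for t
          using observer_row_degree[OF A C K monic Y l carrier(1)[of t]] by (simp add: e_def T_def d_def)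
        have meas: "e k \<in> borel_measurable lebesgue" if "k \<le> d" for k
        proof (cases "k = d")
          case True
          then have "e k = (\<lambda>_. 0)"
            using e_d by auto
          then show ?thesis
            by simp
        next
          case False
          then show ?thesis
            using ed[of k] that by (auto simp: is_weak_derivative_def intro: locally_integrable_measurable)
        qed
        have step: "is_weak_derivative (e k) (\<lambda>t. e (Suc k) t - coeff a (d - Suc k) * e 0 t)" if k: "k < d" for k
        \<comment> \<open>The two expressions for the derivative agree only where the equations for
          x', w' and y hold, that is almost everywhere.\<close>
        proof (rule is_weak_derivative_AE_cong[OF ed[OF k]])
          show "(\<lambda>t. e (Suc k) t - coeff a (d - Suc k) * e 0 t) \<in> borel_measurable lebesgue"
            using meas[of "Suc k"] meas[of 0] k by simp
          show "AE t in lebesgue. e' k t = e (Suc k) t - coeff a (d - Suc k) * e 0 t"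
            using x'(2) w'(2) y
          proof eventually_elim
            case (elim t)
            note I = less_q[OF k l]
            have w't: "w' t $ (k * r + l) = (if Suc k < d then w t $ (Suc k * r + l) else 0) - b k * w t $ l
                + (\<Sum>s<n. T l k s * (B *\<^sub>v u t) $ s) + (\<Sum>i<p. G l k i * (C *\<^sub>v x t) $ i)"
            proof -
              have "w' t $ (k * r + l) = (N *\<^sub>v w t) $ (k * r + l) + (H *\<^sub>v u t) $ (k * r + l) + (L *\<^sub>v y t) $ (k * r + l)"
                unfolding elim(2) using I N H L by (simp del: index_mult_mat_vec)
              moreover have "(L *\<^sub>v y t) $ (k * r + l) = (\<Sum>i<p. G l k i * (C *\<^sub>v x t) $ i) + (\<Sum>i<p. G l k i * (D *\<^sub>v u t) $ i)"
                unfolding Ly[OF carrier(3) k l] unfolding elim(3) using C D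
                by (simp add: distrib_left sum.distrib del: index_mult_mat_vec)
              ultimately show ?thesis
                unfolding Nw[OF carrier(4) k l] Hu[OF carrier(2) k l] by simp
            qed
            have x't: "(\<Sum>s<n. T l k s * x' t $ s) = (\<Sum>s<n. T l k s * (A *\<^sub>v x t) $ s) + (\<Sum>s<n. T l k s * (B *\<^sub>v u t) $ s)"
              unfolding elim(1) using A B by (simp add: distrib_left sum.distrib del: index_mult_mat_vec)
            \<comment> \<open>Eliminating T_k A x in favour of T_{k+1} x cancels the terms with
              \<open>G\<close> and leaves -b_k (w_0 - K x), that is
              \<open>- b k * e 0 t\<close>.\<close>
            have Tx: "(\<Sum>s<n. T l (Suc k) s * x t $ s) = (\<Sum>s<n. T l k s * (A *\<^sub>v x t) $ s) + b k * (K *\<^sub>v x t) $ l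
                - (\<Sum>i<p. G l k i * (C *\<^sub>v x t) $ i)"
              unfolding T_def b_def G_def d_def by (rule observer_row_Suc[OF A C K l carrier(1)])
            have e0: "e 0 t = w t $ l - (K *\<^sub>v x t) $ l"
              using deg mult_mat_vec_nth[OF K carrier(1) l] by (simp add: e_def T_def d_def del: index_mult_mat_vec)
            show ?case
              unfolding e'_def w't x't e_def[of "Suc k"] Tx b_def[symmetric] e0 by (simp add: algebra_simps)
          qed
        qed
        obtain E where E: "AE t in lebesgue. 0 \<le> t \<longrightarrow> e 0 t = E t" "(E \<longlongrightarrow> 0) at_top"
          using weak_ode_tendsto_0[OF monic d_def[symmetric] _ stable e_d step] deg by (auto simp: d_def)
        have "AE t in lebesgue. 0 \<le> t \<longrightarrow> (zh t - z t) $ l = E t"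
          using E(1) z zh
        proof eventually_elim
          case (elim t)
          have "(zh t - z t) $ l = e 0 t"
            using carrier(5)[of t] l elim(2,3) Rw[OF carrier(4) l] deg mult_mat_vec_nth[OF K carrier(1) l, of t] K
            by (simp add: e_def T_def d_def del: index_mult_mat_vec)
          then show ?case
            using elim(1) by simp
        qed
        with E(2) show ?thesis
          by blast
      qed
    qed
  qed
  with N H L R show ?thesis
    by blast
qed

end
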